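(* Let $H$ be a Hopf algebra and let $X$ be a cocommutative coalgebra on which $H$ acts (on the right), such that the action is compatible with the comultiplication of $X$. Suppose $X$ is a categorical augmented rack with augmentation map $\nu:X\to H$ (in particular $\nu$ is a coalgebra morphism). Let $q(x\otimes y)=x\cdot\nu(y)$ and let $R:X\otimes X\to X\otimes X$ be the linear map $R(x\otimes y)=y^{(1)}\otimes q(x\otimes y^{(2)})$. Then $R$ is a Yang-Baxter operator, i.e. it satisfies the Yang-Baxter equation $$(R\otimes\mathbb{1})(\mathbb{1}\otimes R)(R\otimes\mathbb{1})=(\mathbb{1}\otimes R)(R\otimes\mathbb{1})(\mathbb{1}\otimes R).$$
   Context: Everything is over a commutative unital ring $\mathbb{k}$; tensor products are over $\mathbb{k}$ and $\mathbb{1}$ is the identity map. A Hopf algebra $H$ has multiplication $\mu$ (written as juxtaposition), unit $\eta$, comultiplication $\Delta_H$, counit $\epsilon$ and antipode $S$. Coalgebras are coassociative and counital; Sweedler notation $\Delta(x)=x^{(1)}\otimes x^{(2)}$ is used with summation suppressed. Categorical augmented rack: let $H$ be a Hopf algebra and let $X$ be a coalgebra (comultiplication $\Delta_X$) that is a right $H$-module with action $x\otimes g\mapsto x\cdot g$, such that the action is compatible with the comultiplication: $\Delta_X(x\cdot g)=(x^{(1)}\cdot g^{(1)})\otimes(x^{(2)}\cdot g^{(2)})$ for all $x\in X$, $g\in H$. An augmentation map is a linear map $\nu:X\to H$ that is a coalgebra morphism, meaning $\Delta_H(\nu(x))=(\nu\otimes\nu)(\Delta_X(x))$ for all $x\in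 X$, and satisfies $\nu(x\cdot g)=S(g^{(1)})\,\nu(x)\,g^{(2)}$ for all $x\in X$, $g\in H$. If such a $\nu$ is given, $X$ is called a categorical augmented rack (over $H$, with augmentation map $\nu$). *)

theory Defs
  imports "HOL-Algebra.Free_Abelian_Groups" "HOL-Algebra.Module"
begin

section \<open>Linear and bilinear maps\<close>

definition linear_map ::
    "'k ring \<Rightarrow> ('k, 'a) module \<Rightarrow> ('k, 'b) module \<Rightarrow> ('a \<Rightarrow> 'b) \<Rightarrow> bool" where
  "linear_map k M N f \<longleftrightarrow>
     f \<in> carrier M \<rightarrow> carrier N \<and>
     (\<forall>x \<in> carrier M. \<forall>y \<in> carrier M. f (x \<oplus>\<^bsub>M\<^esub> y) = f x \<oplus>\<^bsub>N\<^esub> f y) \<and>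
     (\<forall>a \<in> carrier k. \<forall>x \<in> carrier M. f (a \<odot>\<^bsub>M\<^esub> x) = a \<odot>\<^bsub>N\<^esub> f x)"

definition bilinear_map ::
    "'k ring \<Rightarrow> ('k, 'a) module \<Rightarrow> ('k, 'b) module \<Rightarrow> ('k, 'c) module \<Rightarrow> ('a \<Rightarrow> 'b \<Rightarrow> 'c) \<Rightarrow> bool"
where
  "bilinear_map k M N P B \<longleftrightarrow>
     (\<forall>x \<in> carrier M. linear_map k N P (B x)) \<and>
     (\<forall>y \<in> carrier N. linear_map k M P (\<lambda>x. B x y))"

definition base_module :: "'k ring \<Rightarrow> ('k, 'k) module" where
  "base_module k =
     \<lparr>carrier = carrier k, monoid.mult = monoid.mult k, one = one k, ring.zero = ring.zero k,
      add = add k, smult = monoid.mult k\<rparr>"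

section \<open>Tensor products of modules over a commutative ring\<close>

text \<open>The tensor product of \<open>M\<close> and \<open>N\<close> over \<open>k\<close> is the free abelian group on
  \<open>carrier M \<times> carrier N\<close> modulo the subgroup generated by the additivity relations in each
  argument and by the balancing relations \<open>(a m, n) - (m, a n)\<close>; its elements are cosets.\<close>

type_synonym ('a, 'b) tensor = "('a \<times> 'b \<Rightarrow>\<^sub>0 int) set"

definition tensor_relations ::
    "'k ring \<Rightarrow> ('k, 'a) module \<Rightarrow> ('k, 'b) module \<Rightarrow> ('a, 'b) tensor" where
  "tensor_relations k M N =
     {frag_of (x \<oplus>\<^bsub>M\<^esub> x', y) - frag_of (x, y) - frag_of (x', y) | x x' y.
        x \<in> carrier M \<and> x' \<in> carrier M \<and> y \<in> carrier N} \<union>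
     {frag_of (x, y \<oplus>\<^bsub>N\<^esub> y') - frag_of (x, y) - frag_of (x, y') | x y y'.
        x \<in> carrier M \<and> y \<in> carrier N \<and> y' \<in> carrier N} \<union>
     {frag_of (a \<odot>\<^bsub>M\<^esub> x, y) - frag_of (x, a \<odot>\<^bsub>N\<^esub> y) | a x y.
        a \<in> carrier k \<and> x \<in> carrier M \<and> y \<in> carrier N}"

definition tensor_null ::
    "'k ring \<Rightarrow> ('k, 'a) module \<Rightarrow> ('k, 'b) module \<Rightarrow> ('a, 'b) tensor" where
  "tensor_null k M N =
     generate (free_Abelian_group (carrier M \<times> carrier N)) (tensor_relations k M N)"

definition tensor_class ::
    "'k ring \<Rightarrow> ('k, 'a) module \<Rightarrow> ('k, 'b) module \<Rightarrow> ('a \<times> 'b \<Rightarrow>\<^sub>0 int) \<Rightarrow> ('a, 'b) tensor" where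
  "tensor_class k M N c = tensor_null k M N #>\<^bsub>free_Abelian_group (carrier M \<times> carrier N)\<^esub> c"

definition pure_tensor ::
    "'k ring \<Rightarrow> ('k, 'a) module \<Rightarrow> ('k, 'b) module \<Rightarrow> 'a \<Rightarrow> 'b \<Rightarrow> ('a, 'b) tensor" where
  "pure_tensor k M N x y = tensor_class k M N (frag_of (x, y))"

text \<open>Scalars act by \<open>a (\<Sum> x\<^sub>i \<otimes> y\<^sub>i) = \<Sum> (a x\<^sub>i) \<otimes> y\<^sub>i\<close>; the result does not depend on the
  representative \<open>c\<close> of the coset \<open>T\<close>. Only the module structure is meant: the \<open>mult\<close> and \<open>one\<close>
  fields that the record type \<open>module\<close> carries are left unspecified.\<close>

definition tensor_module ::
    "'k ring \<Rightarrow> ('k, 'a) module \<Rightarrow> ('k, 'b) module \<Rightarrow> ('k, ('a, 'b) tensor) module" where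
  "tensor_module k M N =
     (let Q = free_Abelian_group (carrier M \<times> carrier N) Mod tensor_null k M N in
      \<lparr>carrier = carrier Q, monoid.mult = undefined, one = undefined,
       ring.zero = one Q, add = monoid.mult Q,
       smult = \<lambda>a T. the_elem
         ((\<lambda>c. tensor_class k M N (frag_extend (\<lambda>(x, y). frag_of (a \<odot>\<^bsub>M\<^esub> x, y)) c)) ` T)\<rparr>)"

text \<open>\<open>tensor_lift P B\<close> is the map to \<open>P\<close> that a bilinear map \<open>B\<close> with values in \<open>P\<close> induces on
  the tensor product: \<open>\<Sum> n\<^sub>i (x\<^sub>i \<otimes> y\<^sub>i)\<close> goes to \<open>\<Sum> n\<^sub>i B x\<^sub>i y\<^sub>i\<close>, whatever the representative.
  It also renders Sweedler notation: an expression in the two components \<open>x1\<close>,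
  \<open>x2\<close> of \<open>\<Delta> x\<close> is \<open>tensor_lift P (\<lambda>x1 x2. ...) (\<Delta> x)\<close>.\<close>

definition tensor_lift ::
    "('k, 'c) module \<Rightarrow> ('a \<Rightarrow> 'b \<Rightarrow> 'c) \<Rightarrow> ('a, 'b) tensor \<Rightarrow> 'c" where
  "tensor_lift P B T = the_elem
     ((\<lambda>c. \<Oplus>\<^bsub>P\<^esub>p \<in> Poly_Mapping.keys c. [Poly_Mapping.lookup c p] \<cdot>\<^bsub>P\<^esub> B (fst p) (snd p)) ` T)"

text \<open>In \<open>tensor_map\<close>, the modules \<open>M\<close> and \<open>N\<close> are the codomains of \<open>f\<close> and \<open>g\<close>.\<close>

definition tensor_map ::
    "'k ring \<Rightarrow> ('k, 'c) module \<Rightarrow> ('k, 'd) module \<Rightarrow> ('a \<Rightarrow> 'c) \<Rightarrow> ('b \<Rightarrow> 'd) \<Rightarrow>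
     ('a, 'b) tensor \<Rightarrow> ('c, 'd) tensor" where
  "tensor_map k M N f g =
     tensor_lift (tensor_module k M N) (\<lambda>x y. pure_tensor k M N (f x) (g y))"

definition tensor_swap ::
    "'k ring \<Rightarrow> ('k, 'a) module \<Rightarrow> ('k, 'b) module \<Rightarrow> ('a, 'b) tensor \<Rightarrow> ('b, 'a) tensor" where
  "tensor_swap k M N = tensor_lift (tensor_module k N M) (\<lambda>x y. pure_tensor k N M y x)"

text \<open>The canonical isomorphisms between \<open>(L \<otimes> M) \<otimes> N\<close> and \<open>L \<otimes> (M \<otimes> N)\<close>.\<close>

definition assoc_right ::
    "'k ring \<Rightarrow> ('k, 'a) module \<Rightarrow> ('k, 'b) module \<Rightarrow> ('k, 'c) module \<Rightarrow>
     (('a, 'b) tensor, 'c) tensor \<Rightarrow> ('a, ('b, 'c) tensor) tensor" where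
  "assoc_right k L M N =
     (let V = tensor_module k L (tensor_module k M N) in
      tensor_lift V (\<lambda>t z. tensor_lift V
        (\<lambda>x y. pure_tensor k L (tensor_module k M N) x (pure_tensor k M N y z)) t))"

definition assoc_left ::
    "'k ring \<Rightarrow> ('k, 'a) module \<Rightarrow> ('k, 'b) module \<Rightarrow> ('k, 'c) module \<Rightarrow>
     ('a, ('b, 'c) tensor) tensor \<Rightarrow> (('a, 'b) tensor, 'c) tensor" where
  "assoc_left k L M N =
     (let V = tensor_module k (tensor_module k L M) N in
      tensor_lift V (\<lambda>x t. tensor_lift V
        (\<lambda>y z. pure_tensor k (tensor_module k L M) N (pure_tensor k L M x y) z) t))"

section \<open>Coalgebras and Hopf algebras\<close>

locale coalgebra = module k C
  for k :: "'k ring" and C :: "('k, 'c) module" +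
  fixes \<Delta> :: "'c \<Rightarrow> ('c, 'c) tensor" and \<epsilon> :: "'c \<Rightarrow> 'k"
  assumes comult_linear: "linear_map k C (tensor_module k C C) \<Delta>"
    and counit_linear: "linear_map k C (base_module k) \<epsilon>"
    and coassoc: "x \<in> carrier C \<Longrightarrow>
      assoc_right k C C C (tensor_map k (tensor_module k C C) C \<Delta> (\<lambda>z. z) (\<Delta> x)) =
      tensor_map k C (tensor_module k C C) (\<lambda>z. z) \<Delta> (\<Delta> x)"
    and counit_left: "x \<in> carrier C \<Longrightarrow> tensor_lift C (\<lambda>x1 x2. \<epsilon> x1 \<odot>\<^bsub>C\<^esub> x2) (\<Delta> x) = x"
    and counit_right: "x \<in> carrier C \<Longrightarrow> tensor_lift C (\<lambda>x1 x2. \<epsilon> x2 \<odot>\<^bsub>C\<^esub> x1) (\<Delta> x) = x"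

definition cocommutative ::
    "'k ring \<Rightarrow> ('k, 'c) module \<Rightarrow> ('c \<Rightarrow> ('c, 'c) tensor) \<Rightarrow> bool" where
  "cocommutative k C \<Delta> \<longleftrightarrow> (\<forall>x \<in> carrier C. tensor_swap k C C (\<Delta> x) = \<Delta> x)"

text \<open>The locale \<open>algebra\<close> of the library requires commutativity, hence the following one.\<close>

locale assoc_algebra = module k A + ring A
  for k :: "'k ring" and A :: "('k, 'a) module" +
  assumes mult_bilinear: "bilinear_map k A A A (\<lambda>x y. x \<otimes>\<^bsub>A\<^esub> y)"

locale hopf_algebra = assoc_algebra k H + coalgebra k H \<Delta> \<epsilon>
  for k :: "'k ring" and H :: "('k, 'h) module"
    and \<Delta> :: "'h \<Rightarrow> ('h, 'h) tensor" and \<epsilon> :: "'h \<Rightarrow> 'k" +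
  fixes S :: "'h \<Rightarrow> 'h"
  assumes comult_mult: "\<lbrakk>g \<in> carrier H; h \<in> carrier H\<rbrakk> \<Longrightarrow>
      \<Delta> (g \<otimes>\<^bsub>H\<^esub> h) =
      tensor_lift (tensor_module k H H) (\<lambda>g1 g2. tensor_lift (tensor_module k H H)
        (\<lambda>h1 h2. pure_tensor k H H (g1 \<otimes>\<^bsub>H\<^esub> h1) (g2 \<otimes>\<^bsub>H\<^esub> h2)) (\<Delta> h)) (\<Delta> g)"
    and comult_one: "\<Delta> \<one>\<^bsub>H\<^esub> = pure_tensor k H H \<one>\<^bsub>H\<^esub> \<one>\<^bsub>H\<^esub>"
    and counit_mult: "\<lbrakk>g \<in> carrier H; h \<in> carrier H\<rbrakk> \<Longrightarrow> \<epsilon> (g \<otimes>\<^bsub>H\<^esub> h) = \<epsilon> g \<otimes>\<^bsub>k\<^esub> \<epsilon> h"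
    and counit_one: "\<epsilon> \<one>\<^bsub>H\<^esub> = \<one>\<^bsub>k\<^esub>"
    and antipode_linear: "linear_map k H H S"
    and antipode_left: "g \<in> carrier H \<Longrightarrow>
      tensor_lift H (\<lambda>g1 g2. S g1 \<otimes>\<^bsub>H\<^esub> g2) (\<Delta> g) = \<epsilon> g \<odot>\<^bsub>H\<^esub> \<one>\<^bsub>H\<^esub>"
    and antipode_right: "g \<in> carrier H \<Longrightarrow>
      tensor_lift H (\<lambda>g1 g2. g1 \<otimes>\<^bsub>H\<^esub> S g2) (\<Delta> g) = \<epsilon> g \<odot>\<^bsub>H\<^esub> \<one>\<^bsub>H\<^esub>"

section \<open>Categorical augmented racks\<close>

text \<open>The action is given as the bilinear map \<open>act x g = x \<cdot> g\<close> corresponding to the linear map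
  \<open>x \<otimes> g \<mapsto> x \<cdot> g\<close>. Neither the action nor \<open>\<nu>\<close> is required to be compatible with the counits.\<close>

locale categorical_augmented_rack =
  HA: hopf_algebra k H \<Delta>\<^sub>H \<epsilon>\<^sub>H S + XC: coalgebra k X \<Delta>\<^sub>X \<epsilon>\<^sub>X
  for k :: "'k ring"
    and H :: "('k, 'h) module" and \<Delta>\<^sub>H :: "'h \<Rightarrow> ('h, 'h) tensor" and \<epsilon>\<^sub>H :: "'h \<Rightarrow> 'k"
    and S :: "'h \<Rightarrow> 'h"
    and X :: "('k, 'x) module" and \<Delta>\<^sub>X :: "'x \<Rightarrow> ('x, 'x) tensor" and \<epsilon>\<^sub>X :: "'x \<Rightarrow> 'k" +
  fixes act :: "'x \<Rightarrow> 'h \<Rightarrow> 'x" and \<nu> :: "'x \<Rightarrow> 'h"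
  assumes act_bilinear: "bilinear_map k X H X act"
    and act_one: "x \<in> carrier X \<Longrightarrow> act x \<one>\<^bsub>H\<^esub> = x"
    and act_mult: "\<lbrakk>x \<in> carrier X; g \<in> carrier H; h \<in> carrier H\<rbrakk> \<Longrightarrow>
      act x (g \<otimes>\<^bsub>H\<^esub> h) = act (act x g) h"
    and comult_act: "\<lbrakk>x \<in> carrier X; g \<in> carrier H\<rbrakk> \<Longrightarrow>
      \<Delta>\<^sub>X (act x g) =
      tensor_lift (tensor_module k X X) (\<lambda>x1 x2. tensor_lift (tensor_module k X X)
        (\<lambda>g1 g2. pure_tensor k X X (act x1 g1) (act x2 g2)) (\<Delta>\<^sub>H g)) (\<Delta>\<^sub>X x)"
    and aug_linear: "linear_map k X H \<nu>"
    and aug_comult: "x \<in> carrier X \<Longrightarrow> \<Delta>\<^sub>H (\<nu> x) = tensor_map k H H \<nu> \<nu> (\<Delta>\<^sub>X x)"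
    and aug_act: "\<lbrakk>x \<in> carrier X; g \<in> carrier H\<rbrakk> \<Longrightarrow>
      \<nu> (act x g) = tensor_lift H (\<lambda>g1 g2. S g1 \<otimes>\<^bsub>H\<^esub> \<nu> x \<otimes>\<^bsub>H\<^esub> g2) (\<Delta>\<^sub>H g)"

definition rack_q ::
    "('k, 'x) module \<Rightarrow> ('x \<Rightarrow> 'h \<Rightarrow> 'x) \<Rightarrow> ('x \<Rightarrow> 'h) \<Rightarrow> ('x, 'x) tensor \<Rightarrow> 'x" where
  "rack_q X act \<nu> = tensor_lift X (\<lambda>x y. act x (\<nu> y))"

definition rack_R ::
    "'k ring \<Rightarrow> ('k, 'x) module \<Rightarrow> ('x \<Rightarrow> ('x, 'x) tensor) \<Rightarrow> ('x \<Rightarrow> 'h \<Rightarrow> 'x) \<Rightarrow> ('x \<Rightarrow> 'h) \<Rightarrow>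
     ('x, 'x) tensor \<Rightarrow> ('x, 'x) tensor" where
  "rack_R k X \<Delta> act \<nu> =
     tensor_lift (tensor_module k X X) (\<lambda>x y. tensor_lift (tensor_module k X X)
       (\<lambda>y1 y2. pure_tensor k X X y1 (rack_q X act \<nu> (pure_tensor k X X x y2))) (\<Delta> y))"

section \<open>Yang-Baxter operators\<close>

text \<open>The threefold tensor power is bracketed as \<open>(V \<otimes> V) \<otimes> V\<close>, so that the second of the
  following two maps has to be conjugated by the associativity isomorphism.\<close>

definition tensor_on_left ::
    "'k ring \<Rightarrow> ('k, 'v) module \<Rightarrow> (('v, 'v) tensor \<Rightarrow> ('v, 'v) tensor) \<Rightarrow>
     (('v, 'v) tensor, 'v) tensor \<Rightarrow> (('v, 'v) tensor, 'v) tensor" where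
  "tensor_on_left k V R = tensor_map k (tensor_module k V V) V R (\<lambda>z. z)"

definition tensor_on_right ::
    "'k ring \<Rightarrow> ('k, 'v) module \<Rightarrow> (('v, 'v) tensor \<Rightarrow> ('v, 'v) tensor) \<Rightarrow>
     (('v, 'v) tensor, 'v) tensor \<Rightarrow> (('v, 'v) tensor, 'v) tensor" where
  "tensor_on_right k V R =
     assoc_left k V V V \<circ> tensor_map k V (tensor_module k V V) (\<lambda>z. z) R \<circ> assoc_right k V V V"

definition yang_baxter_operator ::
    "'k ring \<Rightarrow> ('k, 'v) module \<Rightarrow> (('v, 'v) tensor \<Rightarrow> ('v, 'v) tensor) \<Rightarrow> bool" where
  "yang_baxter_operator k V R \<longleftrightarrow>
     linear_map k (tensor_module k V V) (tensor_module k V V) R \<and>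
     (\<forall>t \<in> carrier (tensor_module k (tensor_module k V V) V).
        tensor_on_left k V R (tensor_on_right k V R (tensor_on_left k V R t)) =
        tensor_on_right k V R (tensor_on_left k V R (tensor_on_right k V R t)))"

end

theory Submission
  imports Defs
begin

text \<open>On \<open>x \<otimes> y \<otimes> z\<close> the left side of the equation is
  \<open>z\<^sub>1 \<otimes> y\<^sub>1 \<cdot> \<nu>(z\<^sub>2) \<otimes> x \<cdot> \<nu>(y\<^sub>2) \<nu>(z\<^sub>3)\<close>, and the right side, as \<open>\<Delta>\<^sub>X\<close> and the action are
  compatible, is \<open>z\<^sub>1 \<otimes> y\<^sub>1 \<cdot> \<nu>(z\<^sub>3) \<otimes> x \<cdot> \<nu>(z\<^sub>2) \<nu>(y\<^sub>2 \<cdot> \<nu>(z\<^sub>4))\<close>. Cocommutativity lets \<open>z\<^sub>2\<close> and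
  \<open>z\<^sub>3\<close> change places, so it suffices that \<open>\<nu>(z\<^sub>1) \<nu>(y \<cdot> \<nu>(z\<^sub>2)) = \<nu>(y) \<nu>(z)\<close>. With \<open>g = \<nu>(z)\<close>
  this is \<open>g\<^sub>1 S(g\<^sub>2) \<nu>(y) g\<^sub>3 = \<nu>(y) g\<close>, an instance of the antipode and counit laws of \<open>H\<close>.\<close>

section \<open>Maps on a tensor product\<close>

text \<open>On group-like elements, \<open>R\<close> is the rack braiding sending
  \<open>(x, y)\<close> to \<open>(y, x \<cdot> \<nu>(y))\<close>, and the key identity is
  \<open>g (inv g h g) = h g\<close>; the antipode stands in for the inverse. A point of a set can
  be copied freely, but the legs of a coproduct come in a fixed order. The key identity needs two
  consecutive legs of \<open>z\<close>, whereas the right side of the equation leaves between them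
  the leg that acts on \<open>y\<^sub>1\<close>. This is the obstruction that cocommutativity
  removes. A Sweedler sum is here the \<open>tensor_lift\<close> of a coset, defined by
  \<open>the_elem\<close>, and its value is under control once the integrand is known to be
  bilinear. Each rewriting is therefore checked on pure tensors and carried over by linearity, and
  the linearity of the integrands has to be established along with every step.\<close>

lemma linear_mapI:
  assumes "\<And>x. x \<in> carrier M \<Longrightarrow> f x \<in> carrier N"
    and "\<And>x y. \<lbrakk>x \<in> carrier M; y \<in> carrier M\<rbrakk> \<Longrightarrow> f (x \<oplus>\<^bsub>M\<^esub> y) = f x \<oplus>\<^bsub>N\<^esub> f y"
    and "\<And>a x. \<lbrakk>a \<in> carrier k; x \<in> carrier M\<rbrakk> \<Longrightarrow> f (a \<odot>\<^bsub>M\<^esub> x) = a \<odot>\<^bsub>N\<^esub> f x"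
  shows "linear_map k M N f"
  using assms by (auto simp: linear_map_def)

lemma linear_map_closed: "\<lbrakk>linear_map k M N f; x \<in> carrier M\<rbrakk> \<Longrightarrow> f x \<in> carrier N"
  by (auto simp: linear_map_def)

lemma linear_map_add:
  "\<lbrakk>linear_map k M N f; x \<in> carrier M; y \<in> carrier M\<rbrakk> \<Longrightarrow> f (x \<oplus>\<^bsub>M\<^esub> y) = f x \<oplus>\<^bsub>N\<^esub> f y"
  by (auto simp: linear_map_def)

lemma linear_map_smult:
  "\<lbrakk>linear_map k M N f; a \<in> carrier k; x \<in> carrier M\<rbrakk> \<Longrightarrow> f (a \<odot>\<^bsub>M\<^esub> x) = a \<odot>\<^bsub>N\<^esub> f x"
  by (auto simp: linear_map_def)

lemma bilinear_mapI:
  assumes "\<And>x. x \<in> carrier M \<Longrightarrow> linear_map k N P (\<lambda>y. B x y)"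
    and "\<And>y. y \<in> carrier N \<Longrightarrow> linear_map k M P (\<lambda>x. B x y)"
  shows "bilinear_map k M N P (\<lambda>x y. B x y)"
  using assms by (auto simp: bilinear_map_def)

lemma bilinear_map_left:
  "\<lbrakk>bilinear_map k M N P B; y \<in> carrier N\<rbrakk> \<Longrightarrow> linear_map k M P (\<lambda>x. B x y)"
  by (auto simp: bilinear_map_def)

lemma bilinear_map_right:
  "\<lbrakk>bilinear_map k M N P B; x \<in> carrier M\<rbrakk> \<Longrightarrow> linear_map k N P (\<lambda>y. B x y)"
  by (auto simp: bilinear_map_def)

lemma bilinear_map_closed:
  "\<lbrakk>bilinear_map k M N P B; x \<in> carrier M; y \<in> carrier N\<rbrakk> \<Longrightarrow> B x y \<in> carrier P"
  by (rule linear_map_closed[OF bilinear_map_right])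

section \<open>Additive extension from a free abelian group\<close>

lemma frag_sum_superset:
  fixes c :: "'p \<Rightarrow>\<^sub>0 int"
  assumes "abelian_group P" "f \<in> S \<rightarrow> carrier P" "finite K" "K \<subseteq> S"
    and "Poly_Mapping.keys c \<subseteq> K"
  shows "(\<Oplus>\<^bsub>P\<^esub>p \<in> Poly_Mapping.keys c. [Poly_Mapping.lookup c p] \<cdot>\<^bsub>P\<^esub> f p) =
    (\<Oplus>\<^bsub>P\<^esub>p \<in> K. [Poly_Mapping.lookup c p] \<cdot>\<^bsub>P\<^esub> f p)"
proof -
  interpret P: abelian_group P by fact
  have f: "f p \<in> carrier P" if "p \<in> K" for p
    using assms that by auto
  show ?thesis
  proof (rule P.add.finprod_mono_neutral_cong_left)
    show "[Poly_Mapping.lookup c p] \<cdot>\<^bsub>P\<^esub> f p = \<zero>\<^bsub>P\<^esub>"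
      if "p \<in> K - Poly_Mapping.keys c" for p
      using that int_pow_0[of "add_monoid P"] by (auto simp: in_keys_iff add_pow_def)
  qed (use assms f in auto)
qed

lemma frag_sum_hom:
  assumes "abelian_group P" "f \<in> S \<rightarrow> carrier P"
  shows "(\<lambda>c. \<Oplus>\<^bsub>P\<^esub>p \<in> Poly_Mapping.keys c. [Poly_Mapping.lookup c p] \<cdot>\<^bsub>P\<^esub> f p)
    \<in> hom (free_Abelian_group S) (add_monoid P)" (is "?h \<in> _")
proof (rule homI)
  interpret P: abelian_group P by fact
  show "?h c \<in> carrier (add_monoid P)" if "c \<in> carrier (free_Abelian_group S)" for c
    using that assms(2) by (auto intro!: P.finsum_closed)
  fix c d
  assume c: "c \<in> carrier (free_Abelian_group S)" and d: "d \<in> carrier (free_Abelian_group S)"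
  let ?K = "Poly_Mapping.keys c \<union> Poly_Mapping.keys d"
  have K: "finite ?K" "?K \<subseteq> S"
    using c d by auto
  have f: "f p \<in> carrier P" if "p \<in> ?K" for p
    using assms(2) K that by auto
  \<comment> \<open>Cancellation can make the support of \<open>c + d\<close> smaller than
    \<open>?K\<close>. Indices outside a support have coefficient 0 and contribute nothing, so all
    three sums may run over \<open>?K\<close> and be compared term by term.\<close>
  note eq = frag_sum_superset[OF assms K]
  have "?h (c + d) = (\<Oplus>\<^bsub>P\<^esub>p \<in> ?K. [Poly_Mapping.lookup (c + d) p] \<cdot>\<^bsub>P\<^esub> f p)"
    by (rule eq) (rule keys_add)
  also have "\<dots> = (\<Oplus>\<^bsub>P\<^esub>p \<in> ?K.
      [Poly_Mapping.lookup c p] \<cdot>\<^bsub>P\<^esub> f p \<oplus>\<^bsub>P\<^esub> [Poly_Mapping.lookup d p] \<cdot>\<^bsub>P\<^esub> f p)"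
    by (rule P.finsum_cong') (use f in \<open>auto simp: lookup_add P.add.int_pow_mult\<close>)
  also have "\<dots> = ?h c \<oplus>\<^bsub>P\<^esub> ?h d"
    using f by (subst (1 2) eq) (auto intro!: P.finsum_addf)
  finally show "?h (c \<otimes>\<^bsub>free_Abelian_group S\<^esub> d) = ?h c \<otimes>\<^bsub>add_monoid P\<^esub> ?h d"
    by simp
qed

lemma frag_sum_of:
  assumes "abelian_group P" "f p \<in> carrier P"
  shows "(\<Oplus>\<^bsub>P\<^esub>q \<in> Poly_Mapping.keys (frag_of p). [Poly_Mapping.lookup (frag_of p) q] \<cdot>\<^bsub>P\<^esub> f q) = f p"
proof -
  interpret P: abelian_group P by fact
  show ?thesis
    using assms(2) P.add.int_pow_1[of "f p"]
    by (simp add: keys_frag_of add_pow_def P.finsum_insert)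
qed

lemma free_Abelian_group_diff_closed:
  assumes "c \<in> carrier (free_Abelian_group S)" "d \<in> carrier (free_Abelian_group S)"
  shows "c - d \<in> carrier (free_Abelian_group S)"
  using assms keys_diff[of c d] by auto

abbreviation tensor_free :: "('k, 'a) module \<Rightarrow> ('k, 'b) module \<Rightarrow> ('a \<times> 'b \<Rightarrow>\<^sub>0 int) monoid" where
  "tensor_free M N \<equiv> free_Abelian_group (carrier M \<times> carrier N)"

section \<open>The tensor product of two modules as a quotient group\<close>

locale module_pair = M: module k M + N: module k N
  for k :: "'k ring" and M :: "('k, 'a) module" and N :: "('k, 'b) module"
begin

abbreviation "cls \<equiv> tensor_class k M N"
abbreviation "ten \<equiv> tensor_module k M N"
abbreviation "pure \<equiv> pure_tensor k M N"

sublocale F: comm_group "tensor_free M N"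
  by (rule abelian_free_Abelian_group)

lemma tensor_relations_subset: "tensor_relations k M N \<subseteq> carrier (tensor_free M N)"
  unfolding tensor_relations_def
  by (auto intro!: free_Abelian_group_diff_closed simp del: carrier_free_Abelian_group_iff)

sublocale null: normal "tensor_null k M N" "tensor_free M N"
  unfolding tensor_null_def
  by (intro F.normal_iff_subgroup[THEN iffD2] F.generate_is_subgroup tensor_relations_subset)

lemma tensor_class_eqI:
  assumes "c \<in> carrier (tensor_free M N)" "d \<in> carrier (tensor_free M N)"
    and "c - d \<in> tensor_null k M N"
  shows "cls c = cls d"
proof -
  have "c \<in> tensor_null k M N #>\<^bsub>tensor_free M N\<^esub> d"
    unfolding r_coset_def using assms(3) by (auto intro!: bexI[of _ "c - d"])
  then show ?thesis
    unfolding tensor_class_def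
    using F.repr_independence assms null.is_subgroup by metis
qed

lemma tensor_relation_null: "r \<in> tensor_relations k M N \<Longrightarrow> r \<in> tensor_null k M N"
  unfolding tensor_null_def by (rule generate.incl)

lemma carrier_tensor: "carrier ten = cls ` carrier (tensor_free M N)"
  by (simp add: tensor_module_def Let_def carrier_FactGroup tensor_class_def)

lemma tensor_add_class:
  assumes "c \<in> carrier (tensor_free M N)" "d \<in> carrier (tensor_free M N)"
  shows "cls c \<oplus>\<^bsub>ten\<^esub> cls d = cls (c + d)"
  using null.rcos_sum[OF assms] by (simp add: tensor_module_def Let_def tensor_class_def)

lemma tensor_zero: "\<zero>\<^bsub>ten\<^esub> = cls 0"
  using F.coset_mult_one[OF null.subset]
  by (simp add: tensor_module_def Let_def tensor_class_def)

lemma abelian_group_tensor: "abelian_group ten"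
proof (rule abelian_groupI)
  note [simp del] = carrier_free_Abelian_group_iff
  have closed: "c + d \<in> carrier (tensor_free M N)" "0 \<in> carrier (tensor_free M N)"
    "- c \<in> carrier (tensor_free M N)"
    if "c \<in> carrier (tensor_free M N)" "d \<in> carrier (tensor_free M N)" for c d
    using that F.m_closed[OF that] F.one_closed free_Abelian_group_diff_closed[of 0 _ c] by auto
  show "x \<oplus>\<^bsub>ten\<^esub> y \<in> carrier ten" if "x \<in> carrier ten" "y \<in> carrier ten" for x y
    using that by (auto simp: carrier_tensor tensor_add_class closed)
  show "\<zero>\<^bsub>ten\<^esub> \<in> carrier ten"
    using F.one_closed by (auto simp: carrier_tensor tensor_zero)
  show "x \<oplus>\<^bsub>ten\<^esub> y \<oplus>\<^bsub>ten\<^esub> z = x \<oplus>\<^bsub>ten\<^esub> (y \<oplus>\<^bsub>ten\<^esub> z)"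
    if "x \<in> carrier ten" "y \<in> carrier ten" "z \<in> carrier ten" for x y z
    using that by (auto simp: carrier_tensor tensor_add_class closed add.assoc)
  show "x \<oplus>\<^bsub>ten\<^esub> y = y \<oplus>\<^bsub>ten\<^esub> x" if "x \<in> carrier ten" "y \<in> carrier ten" for x y
    using that by (auto simp: carrier_tensor tensor_add_class add.commute)
  show "\<zero>\<^bsub>ten\<^esub> \<oplus>\<^bsub>ten\<^esub> x = x" if "x \<in> carrier ten" for x
    using that by (auto simp: carrier_tensor tensor_add_class tensor_zero closed)
  show "\<exists>y \<in> carrier ten. y \<oplus>\<^bsub>ten\<^esub> x = \<zero>\<^bsub>ten\<^esub>" if x: "x \<in> carrier ten" for x
  proof -
    obtain c where c: "c \<in> carrier (tensor_free M N)" "x = cls c"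
      using x by (auto simp: carrier_tensor)
    then have "cls (- c) \<oplus>\<^bsub>ten\<^esub> x = \<zero>\<^bsub>ten\<^esub>" "cls (- c) \<in> carrier ten"
      by (simp_all add: tensor_add_class closed tensor_zero carrier_tensor)
    then show ?thesis
      by blast
  qed
qed

text \<open>Scalar multiplication and \<open>tensor_lift\<close> are both defined by
  \<open>the_elem\<close> of the image of a coset. If \<phi> kills the generating relations, its
  kernel contains the subgroup they generate, so \<phi> is constant on each coset and the image is a
  singleton. Independence of the representative is settled here for both.\<close>

lemma the_elem_image_class:
  assumes \<phi>: "\<phi> \<in> hom (tensor_free M N) G" and G: "group G"
    and rel: "\<And>r. r \<in> tensor_relations k M N \<Longrightarrow> \<phi> r = \<one>\<^bsub>G\<^esub>"
    and c: "c \<in> carrier (tensor_free M N)"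
  shows "the_elem (\<phi> ` cls c) = \<phi> c"
proof -
  interpret \<phi>: group_hom "tensor_free M N" G \<phi>
    using \<phi> G by (simp add: group_hom_def group_hom_axioms_def)
  have "tensor_null k M N \<subseteq> kernel (tensor_free M N) G \<phi>"
    unfolding tensor_null_def
    by (rule F.generate_subgroup_incl[OF _ \<phi>.subgroup_kernel])
      (use rel tensor_relations_subset in
        \<open>auto simp: kernel_def simp del: carrier_free_Abelian_group_iff\<close>)
  then have n: "\<phi> n = \<one>\<^bsub>G\<^esub>" "n \<in> carrier (tensor_free M N)" if "n \<in> tensor_null k M N" for n
    using that by (auto simp: kernel_def)
  have "\<phi> d = \<phi> c" if d: "d \<in> cls c" for d
  proof -
    obtain m where m: "m \<in> tensor_null k M N" "d = m \<otimes>\<^bsub>tensor_free M N\<^esub> c"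
      using d unfolding tensor_class_def r_coset_def by blast
    have "\<phi> d = \<phi> m \<otimes>\<^bsub>G\<^esub> \<phi> c"
      unfolding m(2) by (rule \<phi>.hom_mult[OF n(2)[OF m(1)] c])
    then show ?thesis
      using \<phi>.hom_closed[OF c] by (simp only: n(1)[OF m(1)] \<phi>.H.l_one)
  qed
  moreover have "c \<in> cls c"
    unfolding tensor_class_def using c null.is_subgroup by (rule F.rcos_self)
  ultimately have "\<phi> ` cls c = {\<phi> c}"
    by blast
  then show ?thesis
    by simp
qed

text \<open>The sum is a homomorphism on formal combinations. Additivity of \<open>B\<close> in
  either argument kills the first two families of \<open>tensor_relations\<close>, and homogeneity
  in both arguments kills the balancing relations, so \<open>the_elem_image_class\<close>
  applies.\<close>

lemma tensor_lift_class:
  assumes P: "module k P" and B: "bilinear_map k M N P B" and c: "c \<in> carrier (tensor_free M N)"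
  shows "tensor_lift P B (cls c) =
    (\<Oplus>\<^bsub>P\<^esub>p \<in> Poly_Mapping.keys c. [Poly_Mapping.lookup c p] \<cdot>\<^bsub>P\<^esub> B (fst p) (snd p))"
    (is "_ = ?h c")
  unfolding tensor_lift_def
proof (rule the_elem_image_class[OF _ _ _ c])
  interpret P: module k P by fact
  have closed: "B x y \<in> carrier P" if "x \<in> carrier M" "y \<in> carrier N" for x y
    using bilinear_map_closed[OF B that] .
  show hom: "?h \<in> hom (tensor_free M N) (add_monoid P)"
    by (rule frag_sum_hom[OF P.abelian_group_axioms]) (auto intro: closed)
  interpret h: group_hom "tensor_free M N" "add_monoid P" ?h
    using hom by unfold_locales
  have h_of: "?h (frag_of (x, y)) = B x y" if "x \<in> carrier M" "y \<in> carrier N" for x y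
    using frag_sum_of[OF P.abelian_group_axioms, of "\<lambda>p. B (fst p) (snd p)" "(x, y)"]
      closed[OF that] by simp
  have h_diff: "?h (u - v) = ?h u \<ominus>\<^bsub>P\<^esub> ?h v"
    if "u \<in> carrier (tensor_free M N)" "v \<in> carrier (tensor_free M N)" for u v
  proof -
    have "?h (u \<otimes>\<^bsub>tensor_free M N\<^esub> inv\<^bsub>tensor_free M N\<^esub> v) = ?h u \<ominus>\<^bsub>P\<^esub> ?h v"
      using that h.hom_mult[of u "inv\<^bsub>tensor_free M N\<^esub> v"] h.hom_inv[of v]
      by (simp only: F.inv_closed a_minus_def a_inv_def) simp
    then show ?thesis
      using that by simp
  qed
  have fc: "frag_of (x, y) \<in> carrier (tensor_free M N)" if "x \<in> carrier M" "y \<in> carrier N" for x y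
    using that by (simp add: keys_frag_of)
  show "?h r = \<one>\<^bsub>add_monoid P\<^esub>" if "r \<in> tensor_relations k M N" for r
    using that unfolding tensor_relations_def
  proof (elim UnE CollectE exE conjE)
    fix x x' y assume *: "x \<in> carrier M" "x' \<in> carrier M" "y \<in> carrier N"
      and r: "r = frag_of (x \<oplus>\<^bsub>M\<^esub> x', y) - frag_of (x, y) - frag_of (x', y)"
    have "?h r = B (x \<oplus>\<^bsub>M\<^esub> x') y \<ominus>\<^bsub>P\<^esub> B x y \<ominus>\<^bsub>P\<^esub> B x' y"
      unfolding r using * by (simp only: h_diff h_of fc free_Abelian_group_diff_closed M.add.m_closed)
    also have "\<dots> = \<zero>\<^bsub>P\<^esub>"
      using * closed linear_map_add[OF bilinear_map_left[OF B]]
      by (simp add: a_minus_def P.M.a_ac P.r_neg P.r_neg2)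
    finally show ?thesis by simp
  next
    fix x y y' assume *: "x \<in> carrier M" "y \<in> carrier N" "y' \<in> carrier N"
      and r: "r = frag_of (x, y \<oplus>\<^bsub>N\<^esub> y') - frag_of (x, y) - frag_of (x, y')"
    have "?h r = B x (y \<oplus>\<^bsub>N\<^esub> y') \<ominus>\<^bsub>P\<^esub> B x y \<ominus>\<^bsub>P\<^esub> B x y'"
      unfolding r using * by (simp only: h_diff h_of fc free_Abelian_group_diff_closed N.add.m_closed)
    also have "\<dots> = \<zero>\<^bsub>P\<^esub>"
      using * closed linear_map_add[OF bilinear_map_right[OF B]]
      by (simp add: a_minus_def P.M.a_ac P.r_neg P.r_neg2)
    finally show ?thesis by simp
  next
    fix a x y assume *: "a \<in> carrier k" "x \<in> carrier M" "y \<in> carrier N"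
      and r: "r = frag_of (a \<odot>\<^bsub>M\<^esub> x, y) - frag_of (x, a \<odot>\<^bsub>N\<^esub> y)"
    have "?h r = B (a \<odot>\<^bsub>M\<^esub> x) y \<ominus>\<^bsub>P\<^esub> B x (a \<odot>\<^bsub>N\<^esub> y)"
      unfolding r using * by (simp only: h_diff h_of fc M.smult_closed N.smult_closed)
    also have "\<dots> = \<zero>\<^bsub>P\<^esub>"
      using * closed linear_map_smult[OF bilinear_map_left[OF B]]
        linear_map_smult[OF bilinear_map_right[OF B]]
      by (simp add: a_minus_def P.r_neg)
    finally show ?thesis by simp
  qed
  show "group (add_monoid P)"
    by (rule P.a_group)
qed

lemma smult_frag_closed:
  assumes "a \<in> carrier k" "c \<in> carrier (tensor_free M N)"
  shows "frag_extend (\<lambda>(x, y). frag_of (a \<odot>\<^bsub>M\<^esub> x, y)) c \<in> carrier (tensor_free M N)"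
proof -
  have "(\<Union>p \<in> Poly_Mapping.keys c. Poly_Mapping.keys (case p of (x, y) \<Rightarrow> frag_of (a \<odot>\<^bsub>M\<^esub> x, y)))
    \<subseteq> carrier M \<times> carrier N"
    using assms by (auto simp: keys_frag_of split: prod.splits)
  with keys_frag_extend[of "\<lambda>(x, y). frag_of (a \<odot>\<^bsub>M\<^esub> x, y)" c] show ?thesis
    by simp
qed

text \<open>Scaling the first coordinates carries \<open>tensor_relations\<close> into itself: an
  additivity relation becomes one of the same kind with \<open>a x\<close> for \<open>x\<close>, and
  a balancing relation for \<open>b\<close> does too, because commutativity of \<open>k\<close>
  turns \<open>a (b x)\<close> into \<open>b (a x)\<close>. So generators are sent to the zero
  class.\<close>

lemma tensor_smult_class:
  assumes a: "a \<in> carrier k" and c: "c \<in> carrier (tensor_free M N)"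
  shows "a \<odot>\<^bsub>ten\<^esub> cls c = cls (frag_extend (\<lambda>(x, y). frag_of (a \<odot>\<^bsub>M\<^esub> x, y)) c)"
    (is "_ = cls (?s c)")
proof -
  interpret T: abelian_group ten
    by (rule abelian_group_tensor)
  note s = smult_frag_closed[OF a]
  have "the_elem ((\<lambda>c. cls (?s c)) ` cls c) = cls (?s c)"
  proof (rule the_elem_image_class[OF _ _ _ c])
    show "(\<lambda>c. cls (?s c)) \<in> hom (tensor_free M N) (add_monoid ten)"
      using s by (intro homI) (auto simp: carrier_tensor tensor_add_class frag_extend_add
          simp del: carrier_free_Abelian_group_iff)
    show "group (add_monoid ten)"
      by (rule T.a_group)
    show "cls (?s r) = \<one>\<^bsub>add_monoid ten\<^esub>" if r: "r \<in> tensor_relations k M N" for r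
    proof -
      have "?s r \<in> tensor_relations k M N"
        using r unfolding tensor_relations_def
      proof (elim UnE CollectE exE conjE, goal_cases)
        case (1 x x' y)
        then show ?case
          using a M.smult_r_distr[of a x x']
          by (intro UnI1 CollectI exI[of _ "a \<odot>\<^bsub>M\<^esub> x"] exI[of _ "a \<odot>\<^bsub>M\<^esub> x'"] exI[of _ y])
            (simp add: frag_extend_diff)
      next
        case (2 x y y')
        then show ?case
          using a
          by (intro UnI1 UnI2 CollectI exI[of _ "a \<odot>\<^bsub>M\<^esub> x"] exI[of _ y] exI[of _ y'])
            (simp add: frag_extend_diff)
      next
        case (3 b x y)
        then show ?case
          using a M.smult_assoc1[of a b x] M.smult_assoc1[of b a x] M.R.m_comm[of a b]
          by (intro UnI2 CollectI exI[of _ b] exI[of _ "a \<odot>\<^bsub>M\<^esub> x"] exI[of _ y])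
            (simp add: frag_extend_diff)
      qed
      then have "cls (?s r) = cls 0"
        using tensor_relations_subset F.one_closed
        by (intro tensor_class_eqI) (auto intro: tensor_relation_null
            simp del: carrier_free_Abelian_group_iff)
      then show ?thesis
        by (simp add: tensor_zero)
    qed
  qed
  then show ?thesis
    by (simp add: tensor_module_def Let_def)
qed

lemma pure_closed: "\<lbrakk>x \<in> carrier M; y \<in> carrier N\<rbrakk> \<Longrightarrow> pure x y \<in> carrier ten"
  by (simp add: carrier_tensor pure_tensor_def keys_frag_of)

lemma tensor_smult_pure:
  "\<lbrakk>a \<in> carrier k; x \<in> carrier M; y \<in> carrier N\<rbrakk> \<Longrightarrow> a \<odot>\<^bsub>ten\<^esub> pure x y = pure (a \<odot>\<^bsub>M\<^esub> x) y"
  by (simp add: pure_tensor_def tensor_smult_class keys_frag_of)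

lemma pure_bilinear: "bilinear_map k M N ten pure"
proof (intro bilinear_mapI linear_mapI)
  fix x y y' assume *: "x \<in> carrier M" "y \<in> carrier N" "y' \<in> carrier N"
  then have "frag_of (x, y \<oplus>\<^bsub>N\<^esub> y') - frag_of (x, y) - frag_of (x, y') \<in> tensor_relations k M N"
    unfolding tensor_relations_def by blast
  then have "frag_of (x, y \<oplus>\<^bsub>N\<^esub> y') - (frag_of (x, y) + frag_of (x, y')) \<in> tensor_null k M N"
    by (simp add: tensor_relation_null diff_diff_add)
  with * show "pure x (y \<oplus>\<^bsub>N\<^esub> y') = pure x y \<oplus>\<^bsub>ten\<^esub> pure x y'"
    using F.m_closed[of "frag_of (x, y)" "frag_of (x, y')"]
    by (simp add: pure_tensor_def tensor_add_class keys_frag_of tensor_class_eqI)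
next
  fix x x' y assume *: "x \<in> carrier M" "x' \<in> carrier M" "y \<in> carrier N"
  then have "frag_of (x \<oplus>\<^bsub>M\<^esub> x', y) - frag_of (x, y) - frag_of (x', y) \<in> tensor_relations k M N"
    unfolding tensor_relations_def by blast
  then have "frag_of (x \<oplus>\<^bsub>M\<^esub> x', y) - (frag_of (x, y) + frag_of (x', y)) \<in> tensor_null k M N"
    by (simp add: tensor_relation_null diff_diff_add)
  with * show "pure (x \<oplus>\<^bsub>M\<^esub> x') y = pure x y \<oplus>\<^bsub>ten\<^esub> pure x' y"
    using F.m_closed[of "frag_of (x, y)" "frag_of (x', y)"]
    by (simp add: pure_tensor_def tensor_add_class keys_frag_of tensor_class_eqI)
next
  fix a x y assume *: "a \<in> carrier k" "x \<in> carrier M" "y \<in> carrier N"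
  then have "frag_of (a \<odot>\<^bsub>M\<^esub> x, y) - frag_of (x, a \<odot>\<^bsub>N\<^esub> y) \<in> tensor_null k M N"
    by (intro tensor_relation_null) (unfold tensor_relations_def, blast)
  with * have "pure (a \<odot>\<^bsub>M\<^esub> x) y = pure x (a \<odot>\<^bsub>N\<^esub> y)"
    by (simp add: pure_tensor_def keys_frag_of tensor_class_eqI)
  with * show "pure x (a \<odot>\<^bsub>N\<^esub> y) = a \<odot>\<^bsub>ten\<^esub> pure x y"
    by (simp add: tensor_smult_pure)
qed (simp_all add: tensor_smult_pure pure_closed)

section \<open>Generation by pure tensors and the module structure\<close>

lemma tensor_minus_class:
  assumes "c \<in> carrier (tensor_free M N)" "d \<in> carrier (tensor_free M N)"
  shows "cls (c - d) = cls c \<ominus>\<^bsub>ten\<^esub> cls d"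
proof -
  interpret T: abelian_group ten
    by (rule abelian_group_tensor)
  have "cls (c - d) \<oplus>\<^bsub>ten\<^esub> cls d = cls c"
    using assms by (subst tensor_add_class) (auto intro!: free_Abelian_group_diff_closed
        simp del: carrier_free_Abelian_group_iff)
  moreover have "cls (c - d) \<in> carrier ten" "cls c \<in> carrier ten" "cls d \<in> carrier ten"
    using assms by (auto intro!: free_Abelian_group_diff_closed
        simp: carrier_tensor simp del: carrier_free_Abelian_group_iff)
  ultimately show ?thesis
    by (metis T.add.inv_solve_right a_minus_def)
qed

text \<open>Every tensor is an integer combination of pure tensors, so no case for scalars of
  \<open>k\<close> is required. Closure under differences, the form of
  \<open>free_Abelian_group_induct\<close>, covers sums and negatives at once.\<close>

lemma tensor_induct [consumes 1, case_names zero pure minus]: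
  assumes t: "t \<in> carrier ten"
    and "Q \<zero>\<^bsub>ten\<^esub>"
    and "\<And>x y. \<lbrakk>x \<in> carrier M; y \<in> carrier N\<rbrakk> \<Longrightarrow> Q (pure x y)"
    and "\<And>t u. \<lbrakk>t \<in> carrier ten; u \<in> carrier ten; Q t; Q u\<rbrakk> \<Longrightarrow> Q (t \<ominus>\<^bsub>ten\<^esub> u)"
  shows "Q t"
proof -
  obtain c where c: "Poly_Mapping.keys c \<subseteq> carrier M \<times> carrier N" "t = cls c"
    using t by (auto simp: carrier_tensor)
  have "Q (cls c)"
    by (rule free_Abelian_group_induct[OF c(1)])
      (use assms(2-) in \<open>auto simp: tensor_zero pure_tensor_def tensor_minus_class carrier_tensor\<close>)
  with c show ?thesis by simp
qed

lemma tensor_smult_hom: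
  assumes a: "a \<in> carrier k"
  shows "(\<lambda>t. a \<odot>\<^bsub>ten\<^esub> t) \<in> hom (add_monoid ten) (add_monoid ten)"
  using F.m_closed smult_frag_closed[OF a] a
  by (intro homI)
    (auto simp: carrier_tensor tensor_add_class tensor_smult_class frag_extend_add
      simp del: carrier_free_Abelian_group_iff)

text \<open>This is about additive homomorphisms because the scalar laws of the tensor product are
  still to be proved, and they are proved with it: each law compares two additive endomorphisms that
  agree on pure tensors.\<close>

lemma tensor_hom_ext:
  assumes P: "abelian_group P"
    and f: "f \<in> hom (add_monoid ten) (add_monoid P)"
    and g: "g \<in> hom (add_monoid ten) (add_monoid P)"
    and pure: "\<And>x y. \<lbrakk>x \<in> carrier M; y \<in> carrier N\<rbrakk> \<Longrightarrow> f (pure x y) = g (pure x y)"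
    and t: "t \<in> carrier ten"
  shows "f t = g t"
proof -
  interpret T: abelian_group ten
    by (rule abelian_group_tensor)
  interpret P: abelian_group P by fact
  interpret f: group_hom "add_monoid ten" "add_monoid P" f
    using f by unfold_locales
  interpret g: group_hom "add_monoid ten" "add_monoid P" g
    using g by unfold_locales
  show ?thesis
    using t
  proof (induction rule: tensor_induct)
    case zero
    then show ?case
      using f.hom_one g.hom_one by simp
  next
    case (minus t u)
    then show ?case
      using f.hom_mult[of t "\<ominus>\<^bsub>ten\<^esub> u"] g.hom_mult[of t "\<ominus>\<^bsub>ten\<^esub> u"] f.hom_inv[of u] g.hom_inv[of u]
      by (simp add: a_minus_def a_inv_def del: f.hom_inv g.hom_inv)
  qed (rule pure)
qed

lemma module_tensor: "module k ten"
proof (rule moduleI)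
  show "cring k"
    by (rule M.R.is_cring)
  show T: "abelian_group ten"
    by (rule abelian_group_tensor)
  interpret T: abelian_group ten
    by (rule T)
  note hom = tensor_smult_hom
  show closed: "a \<odot>\<^bsub>ten\<^esub> t \<in> carrier ten" if "a \<in> carrier k" "t \<in> carrier ten" for a t
    using hom_in_carrier[OF hom[OF that(1)], of t] that by simp
  show add: "a \<odot>\<^bsub>ten\<^esub> (t \<oplus>\<^bsub>ten\<^esub> u) = a \<odot>\<^bsub>ten\<^esub> t \<oplus>\<^bsub>ten\<^esub> a \<odot>\<^bsub>ten\<^esub> u"
    if "a \<in> carrier k" "t \<in> carrier ten" "u \<in> carrier ten" for a t u
    using hom_mult[OF hom[OF that(1)], of t u] that by simp
  show "(a \<oplus>\<^bsub>k\<^esub> b) \<odot>\<^bsub>ten\<^esub> t = a \<odot>\<^bsub>ten\<^esub> t \<oplus>\<^bsub>ten\<^esub> b \<odot>\<^bsub>ten\<^esub> t"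
    if ab: "a \<in> carrier k" "b \<in> carrier k" and t: "t \<in> carrier ten" for a b t
  proof (rule tensor_hom_ext[OF T _ _ _ t])
    show "(\<lambda>t. (a \<oplus>\<^bsub>k\<^esub> b) \<odot>\<^bsub>ten\<^esub> t) \<in> hom (add_monoid ten) (add_monoid ten)"
      using ab by (intro hom) simp
    show "(\<lambda>t. a \<odot>\<^bsub>ten\<^esub> t \<oplus>\<^bsub>ten\<^esub> b \<odot>\<^bsub>ten\<^esub> t) \<in> hom (add_monoid ten) (add_monoid ten)"
      using ab by (intro homI) (auto simp: add closed T.a_ac)
    show "(a \<oplus>\<^bsub>k\<^esub> b) \<odot>\<^bsub>ten\<^esub> pure x y = a \<odot>\<^bsub>ten\<^esub> pure x y \<oplus>\<^bsub>ten\<^esub> b \<odot>\<^bsub>ten\<^esub> pure x y"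
      if "x \<in> carrier M" "y \<in> carrier N" for x y
      using that ab by (simp add: tensor_smult_pure M.smult_l_distr
          linear_map_add[OF bilinear_map_left[OF pure_bilinear]])
  qed
  show "(a \<otimes>\<^bsub>k\<^esub> b) \<odot>\<^bsub>ten\<^esub> t = a \<odot>\<^bsub>ten\<^esub> (b \<odot>\<^bsub>ten\<^esub> t)"
    if ab: "a \<in> carrier k" "b \<in> carrier k" and t: "t \<in> carrier ten" for a b t
  proof (rule tensor_hom_ext[OF T _ _ _ t])
    show "(\<lambda>t. (a \<otimes>\<^bsub>k\<^esub> b) \<odot>\<^bsub>ten\<^esub> t) \<in> hom (add_monoid ten) (add_monoid ten)"
      using ab by (intro hom) simp
    show "(\<lambda>t. a \<odot>\<^bsub>ten\<^esub> (b \<odot>\<^bsub>ten\<^esub> t)) \<in> hom (add_monoid ten) (add_monoid ten)"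
      using ab by (intro homI) (auto simp: add closed)
    show "(a \<otimes>\<^bsub>k\<^esub> b) \<odot>\<^bsub>ten\<^esub> pure x y = a \<odot>\<^bsub>ten\<^esub> (b \<odot>\<^bsub>ten\<^esub> pure x y)"
      if "x \<in> carrier M" "y \<in> carrier N" for x y
      using that ab by (simp add: tensor_smult_pure M.smult_assoc1)
  qed
  show "\<one>\<^bsub>k\<^esub> \<odot>\<^bsub>ten\<^esub> t = t" if t: "t \<in> carrier ten" for t
  proof (rule tensor_hom_ext[OF T _ _ _ t])
    show "(\<lambda>t. \<one>\<^bsub>k\<^esub> \<odot>\<^bsub>ten\<^esub> t) \<in> hom (add_monoid ten) (add_monoid ten)"
      by (intro hom) simp
    show "(\<lambda>t. t) \<in> hom (add_monoid ten) (add_monoid ten)"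
      by (intro homI) auto
    show "\<one>\<^bsub>k\<^esub> \<odot>\<^bsub>ten\<^esub> pure x y = pure x y" if "x \<in> carrier M" "y \<in> carrier N" for x y
      using that by (simp add: tensor_smult_pure)
  qed
qed

lemma tensor_linear_ext:
  assumes "module k P" "linear_map k ten P f" "linear_map k ten P g"
    and "\<And>x y. \<lbrakk>x \<in> carrier M; y \<in> carrier N\<rbrakk> \<Longrightarrow> f (pure x y) = g (pure x y)"
    and "t \<in> carrier ten"
  shows "f t = g t"
proof (rule tensor_hom_ext[where P = P, OF _ _ _ _ assms(5)])
  show "abelian_group P"
    using assms(1) by (simp add: module_def)
  show "f (pure x y) = g (pure x y)" if "x \<in> carrier M" "y \<in> carrier N" for x y
    by (rule assms(4)) (fact that)+
qed (use assms(2,3) in \<open>auto simp: linear_map_def hom_def\<close>)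

section \<open>The universal property\<close>

lemma tensor_lift_pure:
  assumes "module k P" "bilinear_map k M N P B" "x \<in> carrier M" "y \<in> carrier N"
  shows "tensor_lift P B (pure x y) = B x y"
proof -
  have "abelian_group P"
    using assms(1) by (simp add: module_def)
  from frag_sum_of[OF this, of "\<lambda>p. B (fst p) (snd p)" "(x, y)"] show ?thesis
    unfolding pure_tensor_def using assms
    by (subst tensor_lift_class) (auto simp: keys_frag_of bilinear_map_closed)
qed

lemma tensor_lift_hom:
  assumes P: "module k P" and B: "bilinear_map k M N P B"
  shows "tensor_lift P B \<in> hom (add_monoid ten) (add_monoid P)"
proof -
  let ?h = "\<lambda>c. \<Oplus>\<^bsub>P\<^esub>p \<in> Poly_Mapping.keys c. [Poly_Mapping.lookup c p] \<cdot>\<^bsub>P\<^esub> B (fst p) (snd p)"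
  have "abelian_group P"
    using P by (simp add: module_def)
  then have "?h \<in> hom (tensor_free M N) (add_monoid P)"
    by (rule frag_sum_hom) (use bilinear_map_closed[OF B] in auto)
  from hom_in_carrier[OF this] hom_mult[OF this] show ?thesis
    using F.m_closed
    by (intro homI) (auto simp: carrier_tensor tensor_add_class tensor_lift_class[OF assms]
        simp del: carrier_free_Abelian_group_iff)
qed

lemma tensor_lift_linear:
  assumes P: "module k P" and B: "bilinear_map k M N P B"
  shows "linear_map k ten P (tensor_lift P B)"
proof (rule linear_mapI)
  interpret P: module k P by fact
  interpret T: module k ten
    by (rule module_tensor)
  note hom = tensor_lift_hom[OF assms]
  show closed: "tensor_lift P B t \<in> carrier P" if "t \<in> carrier ten" for t
    using hom_in_carrier[OF hom, of t] that by simp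
  show add: "tensor_lift P B (t \<oplus>\<^bsub>ten\<^esub> u) = tensor_lift P B t \<oplus>\<^bsub>P\<^esub> tensor_lift P B u"
    if "t \<in> carrier ten" "u \<in> carrier ten" for t u
    using hom_mult[OF hom, of t u] that by simp
  show "tensor_lift P B (a \<odot>\<^bsub>ten\<^esub> t) = a \<odot>\<^bsub>P\<^esub> tensor_lift P B t"
    if a: "a \<in> carrier k" and t: "t \<in> carrier ten" for a t
  proof (rule tensor_hom_ext[OF P.abelian_group_axioms _ _ _ t])
    show "(\<lambda>t. tensor_lift P B (a \<odot>\<^bsub>ten\<^esub> t)) \<in> hom (add_monoid ten) (add_monoid P)"
      using a by (intro homI) (auto simp: closed add T.smult_r_distr)
    show "(\<lambda>t. a \<odot>\<^bsub>P\<^esub> tensor_lift P B t) \<in> hom (add_monoid ten) (add_monoid P)"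
      using a by (intro homI) (auto simp: closed add P.smult_r_distr)
    show "tensor_lift P B (a \<odot>\<^bsub>ten\<^esub> pure x y) = a \<odot>\<^bsub>P\<^esub> tensor_lift P B (pure x y)"
      if "x \<in> carrier M" "y \<in> carrier N" for x y
      using that a linear_map_smult[OF bilinear_map_left[OF B]]
      by (simp add: tensor_smult_pure tensor_lift_pure[OF assms])
  qed
qed

lemma tensor_lift_cong:
  assumes "module k P" "bilinear_map k M N P B" "bilinear_map k M N P B'"
    and "\<And>x y. \<lbrakk>x \<in> carrier M; y \<in> carrier N\<rbrakk> \<Longrightarrow> B x y = B' x y"
    and "t \<in> carrier ten"
  shows "tensor_lift P B t = tensor_lift P B' t"
  by (rule tensor_linear_ext[OF assms(1) _ _ _ assms(5)])
    (use assms in \<open>auto simp: tensor_lift_linear tensor_lift_pure\<close>)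

lemma linear_tensor_lift:
  assumes P: "module k P" and Q: "module k Q" and f: "linear_map k P Q f"
    and B: "bilinear_map k M N P B" and t: "t \<in> carrier ten"
  shows "f (tensor_lift P B t) = tensor_lift Q (\<lambda>x y. f (B x y)) t"
proof -
  have B': "bilinear_map k M N Q (\<lambda>x y. f (B x y))"
    using B f by (auto simp: bilinear_map_def linear_map_def Pi_iff)
  show ?thesis
  proof (rule tensor_linear_ext[OF Q _ _ _ t])
    show "linear_map k ten Q (\<lambda>t. f (tensor_lift P B t))"
      using f tensor_lift_linear[OF P B] by (auto simp: linear_map_def Pi_iff)
  qed (simp_all add: tensor_lift_linear tensor_lift_pure P Q B B')
qed

text \<open>The workhorse of the later computations: multiplication in the Hopf algebra and the two
  operators on the threefold tensor power pass through Sweedler sums by this rule, which rewrites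
  the integrand in the same step.\<close>

lemma linear_tensor_lift_eq:
  assumes P: "module k P" and Q: "module k Q" and f: "linear_map k P Q f"
    and B: "bilinear_map k M N P B" and B': "bilinear_map k M N Q B'"
    and eq: "\<And>x y. \<lbrakk>x \<in> carrier M; y \<in> carrier N\<rbrakk> \<Longrightarrow> f (B x y) = B' x y"
    and t: "t \<in> carrier ten"
  shows "f (tensor_lift P B t) = tensor_lift Q B' t"
proof -
  have "bilinear_map k M N Q (\<lambda>x y. f (B x y))"
    using B f by (auto simp: bilinear_map_def linear_map_def Pi_iff)
  with assms show ?thesis
    by (simp add: linear_tensor_lift[OF P Q f B t] tensor_lift_cong[OF Q _ B' eq t])
qed

end

section \<open>Linearity in one variable at a time\<close>

named_theorems linear_intros

lemma linear_ident [linear_intros]: "linear_map k M M (\<lambda>x. x)"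
  by (rule linear_mapI) simp_all

text \<open>This stays out of \<open>linear_intros\<close>, since its conclusion matches every
  linearity goal, with \<open>f\<close> or \<open>g\<close> the identity. Rules such as
  \<open>linear_pure_left\<close> carry an inner function of their own, so that the outermost
  operation of an expression decides which rule applies.\<close>

lemma linear_comp:
  "\<lbrakk>linear_map k N P f; linear_map k M N g\<rbrakk> \<Longrightarrow> linear_map k M P (\<lambda>x. f (g x))"
  by (auto simp: linear_map_def Pi_iff)

declare bilinear_mapI [linear_intros]

lemma module_tensor_module [linear_intros]:
  "\<lbrakk>module k M; module k N\<rbrakk> \<Longrightarrow> module k (tensor_module k M N)"
  by (rule module_pair.module_tensor) (rule module_pair.intro)

context
  fixes k :: "'k ring" and M :: "('k, 'a) module" and N :: "('k, 'b) module"
  assumes M: "module k M" and N: "module k N"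
begin

interpretation module_pair k M N
  using M N by (rule module_pair.intro)

lemma linear_pure_left [linear_intros]:
  "\<lbrakk>linear_map k L M f; y \<in> carrier N\<rbrakk>
    \<Longrightarrow> linear_map k L (tensor_module k M N) (\<lambda>x. pure_tensor k M N (f x) y)"
  by (rule linear_comp[OF bilinear_map_left[OF pure_bilinear]])

lemma linear_pure_right [linear_intros]:
  "\<lbrakk>linear_map k L N g; x \<in> carrier M\<rbrakk>
    \<Longrightarrow> linear_map k L (tensor_module k M N) (\<lambda>y. pure_tensor k M N x (g y))"
  by (rule linear_comp[OF bilinear_map_right[OF pure_bilinear]])

lemma linear_lift_arg:
  "\<lbrakk>linear_map k L (tensor_module k M N) g; module k P; bilinear_map k M N P F\<rbrakk>
    \<Longrightarrow> linear_map k L P (\<lambda>x. tensor_lift P F (g x))"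
  by (rule linear_comp[OF tensor_lift_linear])

text \<open>The variable \<open>x\<close> sits in the integrand while \<open>t\<close> is fixed, so
  \<open>tensor_lift_linear\<close> does not give this directly. For fixed \<open>x\<close>,
  additivity and homogeneity are equations between linear functions of \<open>t\<close>, and on pure
  tensors they are the assumption \<open>lin\<close>. That \<open>a\<close> times a lift is again
  linear in \<open>t\<close> uses commutativity of \<open>k\<close>.\<close>

lemma linear_lift_inner:
  assumes P: "module k P" and t: "t \<in> carrier (tensor_module k M N)"
    and lin: "\<And>a b. \<lbrakk>a \<in> carrier M; b \<in> carrier N\<rbrakk> \<Longrightarrow> linear_map k L P (\<lambda>x. F x a b)"
    and bil: "\<And>x. x \<in> carrier L \<Longrightarrow> bilinear_map k M N P (\<lambda>a b. F x a b)"
    and L: "module k L"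
  shows "linear_map k L P (\<lambda>x. tensor_lift P (\<lambda>a b. F x a b) t)"
proof (rule linear_mapI)
  interpret P: module k P by fact
  interpret L: module k L by fact
  show "tensor_lift P (\<lambda>a b. F x a b) t \<in> carrier P" if "x \<in> carrier L" for x
    using linear_map_closed[OF tensor_lift_linear[OF P bil[OF that]] t] .
  have ext: "f t = g t"
    if "linear_map k ten P f" "linear_map k ten P g"
      and "\<And>x y. \<lbrakk>x \<in> carrier M; y \<in> carrier N\<rbrakk> \<Longrightarrow> f (pure x y) = g (pure x y)" for f g
    using tensor_linear_ext[OF P that t] .
  show "tensor_lift P (F (x \<oplus>\<^bsub>L\<^esub> y)) t = tensor_lift P (F x) t \<oplus>\<^bsub>P\<^esub> tensor_lift P (F y) t"
    if xy: "x \<in> carrier L" "y \<in> carrier L" for x y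
  proof (rule ext)
    note lift = tensor_lift_linear[OF P bil]
    show "linear_map k ten P (\<lambda>t. tensor_lift P (F x) t \<oplus>\<^bsub>P\<^esub> tensor_lift P (F y) t)"
      using lift[OF xy(1)] lift[OF xy(2)]
      by (auto simp: linear_map_def Pi_iff P.smult_r_distr P.M.a_ac)
  qed (use xy in \<open>simp_all add: tensor_lift_linear tensor_lift_pure P bil linear_map_add[OF lin]\<close>)
  show "tensor_lift P (F (a \<odot>\<^bsub>L\<^esub> x)) t = a \<odot>\<^bsub>P\<^esub> tensor_lift P (F x) t"
    if ax: "a \<in> carrier k" "x \<in> carrier L" for a x
  proof (rule ext)
    show "linear_map k ten P (\<lambda>t. a \<odot>\<^bsub>P\<^esub> tensor_lift P (F x) t)"
      using tensor_lift_linear[OF P bil[OF ax(2)]] ax(1)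
      by (auto simp: linear_map_def Pi_iff P.smult_r_distr M.R.m_comm simp flip: P.smult_assoc1)
  qed (use ax in \<open>simp_all add: tensor_lift_linear tensor_lift_pure P bil linear_map_smult[OF lin]\<close>)
qed

end

section \<open>Interchange of lifts and functoriality of the tensor product\<close>

context
  fixes k :: "'k ring" and M :: "('k, 'a) module" and N :: "('k, 'b) module"
  assumes M: "module k M" and N: "module k N"
begin

interpretation module_pair k M N
  using M N by (rule module_pair.intro)

text \<open>A Fubini rule for two independent Sweedler sums. It is wanted because the two sides of
  the Yang-Baxter equation produce the coproducts of \<open>y\<close> and \<open>z\<close> nested in
  different orders. Both sides are linear in \<open>t\<close>, and for pure \<open>t\<close> each is
  the same lift over \<open>s\<close>.\<close>

lemma tensor_lift_commute:
  assumes A: "module k A" and B: "module k B" and P: "module k P"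
    and s: "s \<in> carrier (tensor_module k M N)" and t: "t \<in> carrier (tensor_module k A B)"
    and ab: "\<And>c d. \<lbrakk>c \<in> carrier M; d \<in> carrier N\<rbrakk> \<Longrightarrow> bilinear_map k A B P (\<lambda>a b. F a b c d)"
    and cd: "\<And>a b. \<lbrakk>a \<in> carrier A; b \<in> carrier B\<rbrakk> \<Longrightarrow> bilinear_map k M N P (\<lambda>c d. F a b c d)"
  shows "tensor_lift P (\<lambda>a b. tensor_lift P (\<lambda>c d. F a b c d) s) t =
    tensor_lift P (\<lambda>c d. tensor_lift P (\<lambda>a b. F a b c d) t) s"
proof -
  interpret AB: module_pair k A B
    using A B by (rule module_pair.intro)
  have outer: "bilinear_map k A B P (\<lambda>a b. tensor_lift P (\<lambda>c d. F a b c d) s)"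
    by (intro bilinear_mapI linear_lift_inner[OF M N P s] A B P cd bilinear_map_left[OF ab]
        bilinear_map_right[OF ab])
  have inner: "bilinear_map k M N P (\<lambda>c d. tensor_lift P (\<lambda>a b. F a b c d) t)"
    if "t \<in> carrier AB.ten" for t
    by (intro bilinear_mapI linear_lift_inner[OF A B P that] M N P ab bilinear_map_left[OF cd]
        bilinear_map_right[OF cd])
  show ?thesis
  proof (rule AB.tensor_linear_ext[OF P _ _ _ t])
    show "linear_map k AB.ten P (tensor_lift P (\<lambda>a b. tensor_lift P (\<lambda>c d. F a b c d) s))"
      by (rule AB.tensor_lift_linear[OF P outer])
    show "linear_map k AB.ten P (\<lambda>t. tensor_lift P (\<lambda>c d. tensor_lift P (\<lambda>a b. F a b c d) t) s)"
      by (intro linear_lift_inner[OF M N P s] module_tensor_module A B P AB.tensor_lift_linear ab inner)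
    show "tensor_lift P (\<lambda>a b. tensor_lift P (\<lambda>c d. F a b c d) s) (AB.pure a b) =
        tensor_lift P (\<lambda>c d. tensor_lift P (\<lambda>a b. F a b c d) (AB.pure a b)) s"
      if "a \<in> carrier A" "b \<in> carrier B" for a b
      using that P outer s cd ab inner[OF AB.pure_closed[OF that]]
      by (auto simp: AB.tensor_lift_pure intro!: tensor_lift_cong)
  qed
qed

lemma tensor_map_bilinear:
  assumes "module k A" "module k B" "linear_map k M A f" "linear_map k N B g"
  shows "bilinear_map k M N (tensor_module k A B) (\<lambda>x y. pure_tensor k A B (f x) (g y))"
proof -
  interpret AB: module_pair k A B
    using assms(1,2) by (rule module_pair.intro)
  show ?thesis
    using assms(3,4)
    by (intro bilinear_mapI linear_comp[OF bilinear_map_left[OF AB.pure_bilinear], where g = f]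
        linear_comp[OF bilinear_map_right[OF AB.pure_bilinear], where g = g])
      (auto intro: linear_map_closed)
qed

lemma tensor_map_linear:
  assumes "module k A" "module k B" "linear_map k M A f" "linear_map k N B g"
  shows "linear_map k (tensor_module k M N) (tensor_module k A B) (tensor_map k A B f g)"
  unfolding tensor_map_def
  by (intro tensor_lift_linear module_tensor_module tensor_map_bilinear assms)

lemma tensor_map_pure:
  assumes "module k A" "module k B" "linear_map k M A f" "linear_map k N B g"
    and "x \<in> carrier M" "y \<in> carrier N"
  shows "tensor_map k A B f g (pure_tensor k M N x y) = pure_tensor k A B (f x) (g y)"
  unfolding tensor_map_def
  by (subst tensor_lift_pure) (intro module_tensor_module tensor_map_bilinear assms refl)+

lemma tensor_swap_bilinear:
  "bilinear_map k M N (tensor_module k N M) (\<lambda>x y. pure_tensor k N M y x)"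
proof -
  interpret NM: module_pair k N M
    using N M by (rule module_pair.intro)
  show ?thesis
    using NM.pure_bilinear by (auto simp: bilinear_map_def)
qed

end

section \<open>The associativity isomorphisms\<close>

context
  fixes k :: "'k ring" and L :: "('k, 'a) module" and M :: "('k, 'b) module"
    and N :: "('k, 'c) module"
  assumes L: "module k L" and M: "module k M" and N: "module k N"
begin

interpretation LM: module_pair k L M
  using L M by (rule module_pair.intro)

interpretation MN: module_pair k M N
  using M N by (rule module_pair.intro)

interpretation R: module_pair k LM.ten N
  using LM.module_tensor N by (rule module_pair.intro)

interpretation A: module_pair k L MN.ten
  using L MN.module_tensor by (rule module_pair.intro)

lemma assoc_right_bilinear:
  "bilinear_map k LM.ten N A.ten (\<lambda>t z. tensor_lift A.ten (\<lambda>x y. A.pure x (MN.pure y z)) t)"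
  by (intro linear_intros linear_lift_inner[of k L M] linear_lift_arg[of k L M] L M N MN.pure_closed)

lemma assoc_right_linear: "linear_map k R.ten A.ten (assoc_right k L M N)"
  unfolding assoc_right_def Let_def
  by (rule R.tensor_lift_linear[OF A.module_tensor assoc_right_bilinear])

lemma assoc_right_pure:
  assumes "x \<in> carrier L" "y \<in> carrier M" "z \<in> carrier N"
  shows "assoc_right k L M N (R.pure (LM.pure x y) z) = A.pure x (MN.pure y z)"
  unfolding assoc_right_def Let_def
  unfolding R.tensor_lift_pure[OF A.module_tensor assoc_right_bilinear
      LM.pure_closed[OF assms(1,2)] assms(3)]
  by (rule LM.tensor_lift_pure[OF A.module_tensor _ assms(1,2)])
    (intro linear_intros L M N MN.pure_closed assms(3))

lemma assoc_left_bilinear: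
  "bilinear_map k L MN.ten R.ten (\<lambda>x t. tensor_lift R.ten (\<lambda>y z. R.pure (LM.pure x y) z) t)"
  by (intro linear_intros linear_lift_inner[of k M N] linear_lift_arg[of k M N] L M N LM.pure_closed)

lemma assoc_left_linear: "linear_map k A.ten R.ten (assoc_left k L M N)"
  unfolding assoc_left_def Let_def
  by (rule A.tensor_lift_linear[OF R.module_tensor assoc_left_bilinear])

lemma assoc_left_pure:
  assumes "x \<in> carrier L" "y \<in> carrier M" "z \<in> carrier N"
  shows "assoc_left k L M N (A.pure x (MN.pure y z)) = R.pure (LM.pure x y) z"
  unfolding assoc_left_def Let_def
  unfolding A.tensor_lift_pure[OF R.module_tensor assoc_left_bilinear
      assms(1) MN.pure_closed[OF assms(2,3)]]
  by (rule MN.tensor_lift_pure[OF R.module_tensor _ assms(2,3)])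
    (intro linear_intros L M N LM.pure_closed assms(1))

end

text \<open>Linearity in each variable separately is what makes both nestings of bilinear lifts in
  \<open>sweedler_coassoc\<close> well behaved.\<close>

definition trilinear_map ::
    "'k ring \<Rightarrow> ('k, 'a) module \<Rightarrow> ('k, 'b) module \<Rightarrow> ('k, 'c) module \<Rightarrow> ('k, 'd) module \<Rightarrow>
     ('a \<Rightarrow> 'b \<Rightarrow> 'c \<Rightarrow> 'd) \<Rightarrow> bool" where
  "trilinear_map k L M N P F \<longleftrightarrow>
     (\<forall>y \<in> carrier M. \<forall>z \<in> carrier N. linear_map k L P (\<lambda>x. F x y z)) \<and>
     (\<forall>x \<in> carrier L. \<forall>z \<in> carrier N. linear_map k M P (\<lambda>y. F x y z)) \<and>
     (\<forall>x \<in> carrier L. \<forall>y \<in> carrier M. linear_map k N P (\<lambda>z. F x y z))"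

lemma trilinear_mapI [linear_intros]:
  assumes "\<And>y z. \<lbrakk>y \<in> carrier M; z \<in> carrier N\<rbrakk> \<Longrightarrow> linear_map k L P (\<lambda>x. F x y z)"
    and "\<And>x z. \<lbrakk>x \<in> carrier L; z \<in> carrier N\<rbrakk> \<Longrightarrow> linear_map k M P (\<lambda>y. F x y z)"
    and "\<And>x y. \<lbrakk>x \<in> carrier L; y \<in> carrier M\<rbrakk> \<Longrightarrow> linear_map k N P (\<lambda>z. F x y z)"
  shows "trilinear_map k L M N P (\<lambda>x y z. F x y z)"
  using assms by (auto simp: trilinear_map_def)

section \<open>Sweedler calculus\<close>

context coalgebra
begin

sublocale CC: module_pair k C C
  by unfold_locales

lemma module_C [linear_intros]: "module k C"
  by (rule module_axioms)

lemma comult_closed [simp]: "x \<in> carrier C \<Longrightarrow> \<Delta> x \<in> carrier (tensor_module k C C)"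
  by (rule linear_map_closed[OF comult_linear])

text \<open>Two rules cover the places where a variable can occur in a Sweedler sum: in the
  integrand, as here, or under the coproduct, as in \<open>linear_sweedler_arg\<close>.\<close>

lemma linear_sweedler_inner [linear_intros]:
  assumes "x \<in> carrier C" "module k L" "module k P"
    and "\<And>a b. \<lbrakk>a \<in> carrier C; b \<in> carrier C\<rbrakk> \<Longrightarrow> linear_map k L P (\<lambda>y. F y a b)"
    and "\<And>y. y \<in> carrier L \<Longrightarrow> bilinear_map k C C P (\<lambda>a b. F y a b)"
  shows "linear_map k L P (\<lambda>y. tensor_lift P (\<lambda>a b. F y a b) (\<Delta> x))"
  using assms by (intro linear_lift_inner[of k C C]) (auto intro: module_C)

lemma linear_sweedler_arg [linear_intros]:
  assumes "linear_map k L C g" "module k P" "bilinear_map k C C P (\<lambda>a b. F a b)"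
  shows "linear_map k L P (\<lambda>y. tensor_lift P (\<lambda>a b. F a b) (\<Delta> (g y)))"
  using assms
  by (intro linear_lift_arg[of k C C] linear_comp[OF comult_linear] module_C)

lemma sweedler_closed:
  "\<lbrakk>x \<in> carrier C; module k P; bilinear_map k C C P F\<rbrakk> \<Longrightarrow> tensor_lift P F (\<Delta> x) \<in> carrier P"
  by (rule linear_map_closed[OF CC.tensor_lift_linear comult_closed])

lemma linear_counit_smult [linear_intros]:
  assumes "module k M" "linear_map k L C f" "m \<in> carrier M"
  shows "linear_map k L M (\<lambda>x. \<epsilon> (f x) \<odot>\<^bsub>M\<^esub> m)"
proof -
  interpret M: module k M by fact
  have "linear_map k C M (\<lambda>x. \<epsilon> x \<odot>\<^bsub>M\<^esub> m)"
    using counit_linear assms(3)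
    by (auto simp: linear_map_def base_module_def M.smult_l_distr M.smult_assoc1 Pi_iff)
  from linear_comp[OF this assms(2)] show ?thesis .
qed

lemma counit_closed [simp]: "x \<in> carrier C \<Longrightarrow> \<epsilon> x \<in> carrier k"
  using linear_map_closed[OF counit_linear] by (simp add: base_module_def)

text \<open>The axiom \<open>coassoc\<close> is an equation between elements of
  \<open>C \<otimes> (C \<otimes> C)\<close>. The trilinear \<open>F\<close> induces a linear map
  \<Phi> on that module, and applying \<Phi> to both sides of the axiom gives the two nested
  lifts.\<close>

lemma sweedler_coassoc:
  assumes x: "x \<in> carrier C" and P: "module k P" and F: "trilinear_map k C C C P F"
  shows "tensor_lift P (\<lambda>u c. tensor_lift P (\<lambda>a b. F a b c) (\<Delta> u)) (\<Delta> x) =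
    tensor_lift P (\<lambda>a u. tensor_lift P (\<lambda>b c. F a b c) (\<Delta> u)) (\<Delta> x)"
proof -
  interpret C_CC: module_pair k C CC.ten
    using module_C CC.module_tensor by (rule module_pair.intro)
  interpret CC_C: module_pair k CC.ten C
    using CC.module_tensor module_C by (rule module_pair.intro)
  have F1: "linear_map k C P (\<lambda>a. F a b c)" if "b \<in> carrier C" "c \<in> carrier C" for b c
    using F that by (simp add: trilinear_map_def)
  have F2: "linear_map k C P (\<lambda>b. F a b c)" if "a \<in> carrier C" "c \<in> carrier C" for a c
    using F that by (simp add: trilinear_map_def)
  have F3: "linear_map k C P (\<lambda>c. F a b c)" if "a \<in> carrier C" "b \<in> carrier C" for a b
    using F that by (simp add: trilinear_map_def)
  note lin = linear_intros P F1 F2 F3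
  have bil: "bilinear_map k C CC.ten P (\<lambda>a t. tensor_lift P (\<lambda>b c. F a b c) t)"
    by (intro lin linear_lift_inner[of k C C] linear_lift_arg[of k C C])
  define \<Phi> where "\<Phi> = tensor_lift P (\<lambda>a t. tensor_lift P (\<lambda>b c. F a b c) t)"
  have \<Phi>: "linear_map k C_CC.ten P \<Phi>"
    unfolding \<Phi>_def by (rule C_CC.tensor_lift_linear[OF P bil])
  have \<Phi>_pure: "\<Phi> (C_CC.pure a t) = tensor_lift P (\<lambda>b c. F a b c) t"
    if "a \<in> carrier C" "t \<in> carrier CC.ten" for a t
    unfolding \<Phi>_def using that by (intro C_CC.tensor_lift_pure[OF P bil])
  have \<Psi>: "linear_map k CC_C.ten P (\<lambda>t. \<Phi> (assoc_right k C C C t))"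
    by (rule linear_comp[OF \<Phi> assoc_right_linear]) (rule module_C)+
  \<comment> \<open>The first factor \<open>s\<close> is an arbitrary tensor, while
    \<open>assoc_right_pure\<close> speaks of pure ones, so \<open>s\<close> is decomposed as
    well.\<close>
  have \<Psi>_pure: "\<Phi> (assoc_right k C C C (CC_C.pure s c)) = tensor_lift P (\<lambda>a b. F a b c) s"
    if c: "c \<in> carrier C" and s: "s \<in> carrier CC.ten" for c s
  proof (rule CC.tensor_linear_ext[OF P _ _ _ s])
    show "linear_map k CC.ten P (\<lambda>s. \<Phi> (assoc_right k C C C (CC_C.pure s c)))"
      by (rule linear_comp[OF \<Psi> bilinear_map_left[OF CC_C.pure_bilinear c]])
    show "linear_map k CC.ten P (tensor_lift P (\<lambda>a b. F a b c))"
      by (intro CC.tensor_lift_linear lin c)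
    show "\<Phi> (assoc_right k C C C (CC_C.pure (CC.pure a b) c)) =
        tensor_lift P (\<lambda>a b. F a b c) (CC.pure a b)"
      if "a \<in> carrier C" "b \<in> carrier C" for a b
    proof -
      have "tensor_lift P (\<lambda>b c. F a b c) (CC.pure b c) = F a b c"
        using that c by (intro CC.tensor_lift_pure lin)
      moreover have "tensor_lift P (\<lambda>a b. F a b c) (CC.pure a b) = F a b c"
        using that c by (intro CC.tensor_lift_pure lin)
      ultimately show ?thesis
        using that c by (simp add: assoc_right_pure module_C \<Phi>_pure CC.pure_closed)
    qed
  qed
  \<comment> \<open>Here and in \<open>right\<close> the claim is about every tensor
    \<open>t\<close>: only as an equation of linear maps in \<open>t\<close> can it be tested on
    pure tensors. It is then used at \<open>\<Delta> x\<close>.\<close>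
  have left: "\<Phi> (assoc_right k C C C (tensor_map k CC.ten C \<Delta> (\<lambda>z. z) t)) =
      tensor_lift P (\<lambda>u c. tensor_lift P (\<lambda>a b. F a b c) (\<Delta> u)) t"
    if t: "t \<in> carrier CC.ten" for t
  proof (rule CC.tensor_linear_ext[OF P _ _ _ t])
    show "linear_map k CC.ten P
        (\<lambda>t. \<Phi> (assoc_right k C C C (tensor_map k CC.ten C \<Delta> (\<lambda>z. z) t)))"
      by (intro linear_comp[OF \<Psi>] tensor_map_linear lin comult_linear)
    have *: "bilinear_map k C C P (\<lambda>u c. tensor_lift P (\<lambda>a b. F a b c) (\<Delta> u))"
      by (intro lin)
    then show "linear_map k CC.ten P (tensor_lift P (\<lambda>u c. tensor_lift P (\<lambda>a b. F a b c) (\<Delta> u)))"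
      by (rule CC.tensor_lift_linear[OF P])
    show "\<Phi> (assoc_right k C C C (tensor_map k CC.ten C \<Delta> (\<lambda>z. z) (CC.pure u c))) =
        tensor_lift P (\<lambda>u c. tensor_lift P (\<lambda>a b. F a b c) (\<Delta> u)) (CC.pure u c)"
      if "u \<in> carrier C" "c \<in> carrier C" for u c
      using that
      by (simp add: tensor_map_pure module_C CC.module_tensor comult_linear linear_ident \<Psi>_pure
          CC.tensor_lift_pure[OF P *])
  qed
  have right: "\<Phi> (tensor_map k C CC.ten (\<lambda>z. z) \<Delta> t) =
      tensor_lift P (\<lambda>a u. tensor_lift P (\<lambda>b c. F a b c) (\<Delta> u)) t"
    if t: "t \<in> carrier CC.ten" for t
  proof (rule CC.tensor_linear_ext[OF P _ _ _ t])
    show "linear_map k CC.ten P (\<lambda>t. \<Phi> (tensor_map k C CC.ten (\<lambda>z. z) \<Delta> t))"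
      by (intro linear_comp[OF \<Phi>] tensor_map_linear lin comult_linear)
    have *: "bilinear_map k C C P (\<lambda>a u. tensor_lift P (\<lambda>b c. F a b c) (\<Delta> u))"
      by (intro lin)
    then show "linear_map k CC.ten P (tensor_lift P (\<lambda>a u. tensor_lift P (\<lambda>b c. F a b c) (\<Delta> u)))"
      by (rule CC.tensor_lift_linear[OF P])
    show "\<Phi> (tensor_map k C CC.ten (\<lambda>z. z) \<Delta> (CC.pure a u)) =
        tensor_lift P (\<lambda>a u. tensor_lift P (\<lambda>b c. F a b c) (\<Delta> u)) (CC.pure a u)"
      if "a \<in> carrier C" "u \<in> carrier C" for a u
      using that
      by (simp add: tensor_map_pure module_C CC.module_tensor comult_linear linear_ident \<Phi>_pure
          CC.tensor_lift_pure[OF P *])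
  qed
  show ?thesis
    using left[OF comult_closed[OF x]] right[OF comult_closed[OF x]] coassoc[OF x] by simp
qed

text \<open>Applying the lift of \<open>F\<close> to
  \<open>tensor_swap k C C (\<Delta> x) = \<Delta> x\<close> moves the flip from the tensor to the
  arguments of \<open>F\<close>.\<close>

lemma sweedler_cocomm:
  assumes "cocommutative k C \<Delta>" and x: "x \<in> carrier C" and P: "module k P"
    and F: "bilinear_map k C C P F"
  shows "tensor_lift P (\<lambda>a b. F a b) (\<Delta> x) = tensor_lift P (\<lambda>a b. F b a) (\<Delta> x)"
proof -
  have F': "bilinear_map k C C P (\<lambda>a b. F b a)"
    using F by (auto simp: bilinear_map_def)
  have "tensor_lift P F (tensor_swap k C C (\<Delta> x)) = tensor_lift P (\<lambda>a b. F b a) (\<Delta> x)"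
    unfolding tensor_swap_def
  proof (rule CC.linear_tensor_lift_eq[OF CC.module_tensor P _ _ F'])
    show "tensor_lift P F (CC.pure b a) = F b a" if "a \<in> carrier C" "b \<in> carrier C" for a b
      by (rule CC.tensor_lift_pure[OF P F that(2,1)])
  qed (use x in \<open>simp_all add: CC.tensor_lift_linear[OF P F] tensor_swap_bilinear module_C\<close>)
  then show ?thesis
    using assms(1) x by (simp add: cocommutative_def)
qed

end

section \<open>The Yang-Baxter equation\<close>

context hopf_algebra
begin

lemma mult_closed [simp]: "\<lbrakk>g \<in> carrier H; h \<in> carrier H\<rbrakk> \<Longrightarrow> g \<otimes>\<^bsub>H\<^esub> h \<in> carrier H"
  by (rule bilinear_map_closed[OF mult_bilinear])

lemma antipode_closed [simp]: "g \<in> carrier H \<Longrightarrow> S g \<in> carrier H"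
  by (rule linear_map_closed[OF antipode_linear])

lemma linear_mult_left [linear_intros]:
  "\<lbrakk>linear_map k L H f; h \<in> carrier H\<rbrakk> \<Longrightarrow> linear_map k L H (\<lambda>x. f x \<otimes>\<^bsub>H\<^esub> h)"
  by (rule linear_comp[OF bilinear_map_left[OF mult_bilinear]])

lemma linear_mult_right [linear_intros]:
  "\<lbrakk>linear_map k L H f; h \<in> carrier H\<rbrakk> \<Longrightarrow> linear_map k L H (\<lambda>x. h \<otimes>\<^bsub>H\<^esub> f x)"
  by (rule linear_comp[OF bilinear_map_right[OF mult_bilinear]])

lemma linear_antipode [linear_intros]:
  "linear_map k L H f \<Longrightarrow> linear_map k L H (\<lambda>x. S (f x))"
  by (rule linear_comp[OF antipode_linear])

lemma linear_smult_right [linear_intros]: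
  assumes a: "a \<in> carrier k" and f: "linear_map k L H f"
  shows "linear_map k L H (\<lambda>x. a \<odot>\<^bsub>H\<^esub> f x)"
  by (rule linear_comp[OF _ f], rule linear_mapI)
    (use a in \<open>simp_all add: smult_r_distr R.m_comm flip: smult_assoc1\<close>)

text \<open>In \<open>g\<^sub>1 S(g\<^sub>2) w g\<^sub>3\<close> the antipode is grouped with
  \<open>g\<^sub>3\<close>, as both come from splitting \<open>b\<close>. Coassociativity groups it
  with \<open>g\<^sub>1\<close> instead. Then \<open>antipode_right\<close> leaves a scalar, which
  moves past \<open>w\<close> to the last leg, and \<open>counit_left\<close> restores
  \<open>g\<close>.\<close>

lemma sweedler_antipode_cancel:
  assumes g: "g \<in> carrier H" and w: "w \<in> carrier H"
  shows "tensor_lift H (\<lambda>a b. a \<otimes>\<^bsub>H\<^esub> tensor_lift H (\<lambda>c d. S c \<otimes>\<^bsub>H\<^esub> w \<otimes>\<^bsub>H\<^esub> d) (\<Delta> b)) (\<Delta> g) =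
    w \<otimes>\<^bsub>H\<^esub> g"
proof -
  note mult_assoc = monoid.m_assoc[OF ring.is_monoid[OF ring_axioms]]
  have "tensor_lift H (\<lambda>a b. a \<otimes>\<^bsub>H\<^esub> tensor_lift H (\<lambda>c d. S c \<otimes>\<^bsub>H\<^esub> w \<otimes>\<^bsub>H\<^esub> d) (\<Delta> b)) (\<Delta> g) =
      tensor_lift H (\<lambda>a b. tensor_lift H (\<lambda>c d. a \<otimes>\<^bsub>H\<^esub> (S c \<otimes>\<^bsub>H\<^esub> (w \<otimes>\<^bsub>H\<^esub> d))) (\<Delta> b)) (\<Delta> g)"
  proof (rule CC.tensor_lift_cong)
    show "a \<otimes>\<^bsub>H\<^esub> tensor_lift H (\<lambda>c d. S c \<otimes>\<^bsub>H\<^esub> w \<otimes>\<^bsub>H\<^esub> d) (\<Delta> b) =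
        tensor_lift H (\<lambda>c d. a \<otimes>\<^bsub>H\<^esub> (S c \<otimes>\<^bsub>H\<^esub> (w \<otimes>\<^bsub>H\<^esub> d))) (\<Delta> b)"
      if "a \<in> carrier H" "b \<in> carrier H" for a b
      by (rule CC.linear_tensor_lift_eq[where f = "\<lambda>h. a \<otimes>\<^bsub>H\<^esub> h"]; (intro linear_intros)?)
        (use that w in \<open>simp_all add: mult_assoc\<close>)
  qed (((intro linear_intros)?; use g w in \<open>simp add: sweedler_closed linear_intros\<close>)+)
  \<comment> \<open>Now \<open>u\<close> holds the first two legs, so that \<open>a\<close> and
    \<open>c\<close> are the two halves of one coproduct.\<close>
  also have "\<dots> =
      tensor_lift H (\<lambda>u d. tensor_lift H (\<lambda>a c. a \<otimes>\<^bsub>H\<^esub> (S c \<otimes>\<^bsub>H\<^esub> (w \<otimes>\<^bsub>H\<^esub> d))) (\<Delta> u)) (\<Delta> g)"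
    by (rule sweedler_coassoc[symmetric], rule g, (intro linear_intros)+) (use w in simp_all)
  also have "\<dots> = tensor_lift H (\<lambda>u d. w \<otimes>\<^bsub>H\<^esub> (\<epsilon> u \<odot>\<^bsub>H\<^esub> d)) (\<Delta> g)"
  proof (rule CC.tensor_lift_cong)
    show "tensor_lift H (\<lambda>a c. a \<otimes>\<^bsub>H\<^esub> (S c \<otimes>\<^bsub>H\<^esub> (w \<otimes>\<^bsub>H\<^esub> d))) (\<Delta> u) =
        w \<otimes>\<^bsub>H\<^esub> (\<epsilon> u \<odot>\<^bsub>H\<^esub> d)"
      if "u \<in> carrier H" "d \<in> carrier H" for u d
    proof -
      have "tensor_lift H (\<lambda>a c. a \<otimes>\<^bsub>H\<^esub> (S c \<otimes>\<^bsub>H\<^esub> (w \<otimes>\<^bsub>H\<^esub> d))) (\<Delta> u) =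
          tensor_lift H (\<lambda>a c. a \<otimes>\<^bsub>H\<^esub> S c) (\<Delta> u) \<otimes>\<^bsub>H\<^esub> (w \<otimes>\<^bsub>H\<^esub> d)"
        by (rule CC.linear_tensor_lift_eq[where f = "\<lambda>h. h \<otimes>\<^bsub>H\<^esub> (w \<otimes>\<^bsub>H\<^esub> d)", symmetric];
            (intro linear_intros)?) (use that w in \<open>simp_all add: mult_assoc\<close>)
      also have "\<dots> = \<epsilon> u \<odot>\<^bsub>H\<^esub> (w \<otimes>\<^bsub>H\<^esub> d)"
        using that w
          linear_map_smult[OF bilinear_map_left[OF mult_bilinear], of "w \<otimes>\<^bsub>H\<^esub> d" "\<epsilon> u" "\<one>\<^bsub>H\<^esub>"]
        by (simp add: antipode_right)
      also have "\<dots> = w \<otimes>\<^bsub>H\<^esub> (\<epsilon> u \<odot>\<^bsub>H\<^esub> d)"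
        using that w linear_map_smult[OF bilinear_map_right[OF mult_bilinear], of w "\<epsilon> u" d] by simp
      finally show ?thesis .
    qed
  qed (((intro linear_intros)?; use g w in simp)+)
  also have "\<dots> = w \<otimes>\<^bsub>H\<^esub> tensor_lift H (\<lambda>u d. \<epsilon> u \<odot>\<^bsub>H\<^esub> d) (\<Delta> g)"
    by (rule CC.linear_tensor_lift_eq[where f = "\<lambda>h. w \<otimes>\<^bsub>H\<^esub> h", symmetric];
        (intro linear_intros)?) (use g w in simp_all)
  also have "\<dots> = w \<otimes>\<^bsub>H\<^esub> g"
    by (simp add: counit_left g)
  finally show ?thesis .
qed

end

section \<open>Coproducts of augmented and acted-on elements\<close>

context categorical_augmented_rack
begin

lemma aug_closed [simp]: "x \<in> carrier X \<Longrightarrow> \<nu> x \<in> carrier H"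
  by (rule linear_map_closed[OF aug_linear])

lemma act_closed [simp]: "\<lbrakk>x \<in> carrier X; h \<in> carrier H\<rbrakk> \<Longrightarrow> act x h \<in> carrier X"
  by (rule bilinear_map_closed[OF act_bilinear])

lemma linear_aug [linear_intros]:
  "linear_map k L X f \<Longrightarrow> linear_map k L H (\<lambda>x. \<nu> (f x))"
  by (rule linear_comp[OF aug_linear])

lemma linear_act_left [linear_intros]:
  "\<lbrakk>linear_map k L X f; h \<in> carrier H\<rbrakk> \<Longrightarrow> linear_map k L X (\<lambda>x. act (f x) h)"
  by (rule linear_comp[OF bilinear_map_left[OF act_bilinear]])

lemma linear_act_right [linear_intros]:
  "\<lbrakk>linear_map k L H f; x \<in> carrier X\<rbrakk> \<Longrightarrow> linear_map k L X (\<lambda>y. act x (f y))"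
  by (rule linear_comp[OF bilinear_map_right[OF act_bilinear]])

text \<open>As \<nu> is a coalgebra morphism, the splitting of \<open>\<nu> z\<close> can be moved
  from \<open>H\<close> to \<open>X\<close>, where cocommutativity is available.\<close>

lemma sweedler_aug:
  assumes z: "z \<in> carrier X" and P: "module k P" and F: "bilinear_map k H H P F"
  shows "tensor_lift P (\<lambda>a b. F a b) (\<Delta>\<^sub>H (\<nu> z)) = tensor_lift P (\<lambda>a b. F (\<nu> a) (\<nu> b)) (\<Delta>\<^sub>X z)"
  unfolding aug_comult[OF z] tensor_map_def
  by (rule XC.CC.linear_tensor_lift_eq[where P = HA.CC.ten])
    (use z F P in \<open>simp_all add: HA.CC.tensor_lift_linear HA.CC.tensor_lift_pure
      linear_intros bilinear_map_left bilinear_map_right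
      linear_comp[OF bilinear_map_left[OF F] aug_linear]
      linear_comp[OF bilinear_map_right[OF F] aug_linear]\<close>)

text \<open>By \<open>comult_act\<close> and \<open>sweedler_aug\<close>, the legs of
  \<open>y \<cdot> \<nu>(z)\<close> are \<open>y\<^sub>1 \<cdot> \<nu>(z\<^sub>1)\<close> and
  \<open>y\<^sub>2 \<cdot> \<nu>(z\<^sub>2)\<close>. This is how the last two of the four legs of
  \<open>z\<close> arise on the right side of the Yang-Baxter equation.\<close>

lemma sweedler_act:
  assumes y: "y \<in> carrier X" and z: "z \<in> carrier X" and P: "module k P"
    and F: "bilinear_map k X X P F"
  shows "tensor_lift P (\<lambda>a b. F a b) (\<Delta>\<^sub>X (act y (\<nu> z))) =
    tensor_lift P (\<lambda>a b. tensor_lift P (\<lambda>c d. F (act a (\<nu> c)) (act b (\<nu> d))) (\<Delta>\<^sub>X z)) (\<Delta>\<^sub>X y)"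
proof -
  have F1: "linear_map k L P (\<lambda>x. F (f x) y)"
    if "linear_map k L X f" "y \<in> carrier X" for L :: "('k, 'l) module" and f y
    by (rule linear_comp[OF bilinear_map_left[OF F that(2)] that(1)])
  have F2: "linear_map k L P (\<lambda>y. F x (f y))"
    if "linear_map k L X f" "x \<in> carrier X" for L :: "('k, 'l) module" and f x
    by (rule linear_comp[OF bilinear_map_right[OF F that(2)] that(1)])
  note lin = linear_intros F1 F2
  have lift_F: "linear_map k XC.CC.ten P (tensor_lift P F)"
    by (rule XC.CC.tensor_lift_linear[OF P F])
  have "tensor_lift P F (tensor_lift XC.CC.ten
        (\<lambda>g1 g2. XC.CC.pure (act a g1) (act b g2)) (\<Delta>\<^sub>H (\<nu> z))) =
      tensor_lift P (\<lambda>c d. F (act a (\<nu> c)) (act b (\<nu> d))) (\<Delta>\<^sub>X z)"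
    if "a \<in> carrier X" "b \<in> carrier X" for a b
  proof -
    have "tensor_lift P F (tensor_lift XC.CC.ten
          (\<lambda>g1 g2. XC.CC.pure (act a g1) (act b g2)) (\<Delta>\<^sub>H (\<nu> z))) =
        tensor_lift P (\<lambda>c d. F (act a c) (act b d)) (\<Delta>\<^sub>H (\<nu> z))"
      by (rule HA.CC.linear_tensor_lift_eq[OF XC.CC.module_tensor P lift_F]; (intro lin)?)
        (use that z in \<open>simp_all add: XC.CC.tensor_lift_pure[OF P F]\<close>)
    also have "\<dots> = tensor_lift P (\<lambda>c d. F (act a (\<nu> c)) (act b (\<nu> d))) (\<Delta>\<^sub>X z)"
      by (rule sweedler_aug[OF z P], (intro lin)+) (use that in simp_all)
    finally show ?thesis .
  qed
  then show ?thesis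
    unfolding comult_act[OF y aug_closed[OF z]]
    by (intro XC.CC.linear_tensor_lift_eq[OF XC.CC.module_tensor P lift_F] lin)
      (use y z P in simp_all)
qed

text \<open>Rack self-distributivity in linear form: letting both sides act on \<open>x\<close>
  gives \<open>(x \<cdot> \<nu>(z\<^sub>1)) \<cdot> \<nu>(y \<cdot> \<nu>(z\<^sub>2)) = (x \<cdot>
  \<nu>(y)) \<cdot> \<nu>(z)\<close>. Over the coproduct of \<open>\<nu> z\<close> in
  \<open>H\<close>, \<open>aug_act\<close> opens the inner \<nu> and the antipode cancels.\<close>

lemma sweedler_aug_act:
  assumes y: "y \<in> carrier X" and z: "z \<in> carrier X"
  shows "tensor_lift H (\<lambda>a b. \<nu> a \<otimes>\<^bsub>H\<^esub> \<nu> (act y (\<nu> b))) (\<Delta>\<^sub>X z) = \<nu> y \<otimes>\<^bsub>H\<^esub> \<nu> z"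
proof -
  have "tensor_lift H (\<lambda>a b. a \<otimes>\<^bsub>H\<^esub> \<nu> (act y b)) (\<Delta>\<^sub>H (\<nu> z)) =
      tensor_lift H (\<lambda>a b. \<nu> a \<otimes>\<^bsub>H\<^esub> \<nu> (act y (\<nu> b))) (\<Delta>\<^sub>X z)"
    by (rule sweedler_aug, rule z, (intro linear_intros)+) (use y in simp_all)
  moreover have "tensor_lift H (\<lambda>a b. a \<otimes>\<^bsub>H\<^esub> \<nu> (act y b)) (\<Delta>\<^sub>H (\<nu> z)) =
      tensor_lift H (\<lambda>a b. a \<otimes>\<^bsub>H\<^esub>
        tensor_lift H (\<lambda>c d. S c \<otimes>\<^bsub>H\<^esub> \<nu> y \<otimes>\<^bsub>H\<^esub> d) (\<Delta>\<^sub>H b)) (\<Delta>\<^sub>H (\<nu> z))"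
    by (rule HA.CC.tensor_lift_cong; (intro linear_intros)?)
      (use y z in \<open>simp_all add: aug_act HA.sweedler_closed linear_intros\<close>)
  ultimately show ?thesis
    using HA.sweedler_antipode_cancel[of "\<nu> z" "\<nu> y"] y z by simp
qed

section \<open>The operator on the twofold and threefold tensor powers\<close>

interpretation T3: module_pair k XC.CC.ten X
  using XC.CC.module_tensor XC.module_C by (rule module_pair.intro)

abbreviation "R \<equiv> rack_R k X \<Delta>\<^sub>X act \<nu>"
abbreviation "R12 \<equiv> tensor_on_left k X R"
abbreviation "R23 \<equiv> tensor_on_right k X R"
abbreviation "pure3 x y z \<equiv> T3.pure (XC.CC.pure x y) z"

lemma linear_rack_q [linear_intros]:
  assumes "linear_map k L XC.CC.ten f"
  shows "linear_map k L X (\<lambda>x. rack_q X act \<nu> (f x))"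
  unfolding rack_q_def
  by (rule linear_comp[OF _ assms], rule XC.CC.tensor_lift_linear, (intro linear_intros)+) simp_all

lemma rack_q_pure: "\<lbrakk>x \<in> carrier X; y \<in> carrier X\<rbrakk> \<Longrightarrow> rack_q X act \<nu> (XC.CC.pure x y) = act x (\<nu> y)"
  unfolding rack_q_def
  by (rule XC.CC.tensor_lift_pure, (intro linear_intros)+) simp_all

lemma rack_q_closed [simp]: "t \<in> carrier XC.CC.ten \<Longrightarrow> rack_q X act \<nu> t \<in> carrier X"
  by (rule linear_map_closed[OF linear_rack_q[OF linear_ident]])

lemma rack_R_bilinear:
  "bilinear_map k X X XC.CC.ten (\<lambda>x y. tensor_lift XC.CC.ten
     (\<lambda>y1 y2. XC.CC.pure y1 (rack_q X act \<nu> (XC.CC.pure x y2))) (\<Delta>\<^sub>X y))"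
  by (intro linear_intros) (simp_all add: XC.CC.pure_closed)

lemma rack_R_linear: "linear_map k XC.CC.ten XC.CC.ten R"
  unfolding rack_R_def by (rule XC.CC.tensor_lift_linear[OF XC.CC.module_tensor rack_R_bilinear])

lemma rack_R_pure:
  assumes "x \<in> carrier X" "y \<in> carrier X"
  shows "R (XC.CC.pure x y) = tensor_lift XC.CC.ten (\<lambda>a b. XC.CC.pure a (act x (\<nu> b))) (\<Delta>\<^sub>X y)"
  unfolding rack_R_def XC.CC.tensor_lift_pure[OF XC.CC.module_tensor rack_R_bilinear assms]
  by (rule XC.CC.tensor_lift_cong; (intro linear_intros)?)
    (use assms in \<open>simp_all add: XC.CC.pure_closed rack_q_pure\<close>)

lemma R12_linear: "linear_map k T3.ten T3.ten R12"
  unfolding tensor_on_left_def by (intro tensor_map_linear linear_intros rack_R_linear)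

lemma R23_linear: "linear_map k T3.ten T3.ten R23"
  unfolding tensor_on_right_def comp_def
  by (intro linear_comp[OF assoc_left_linear]
      linear_comp[OF tensor_map_linear[where M = X and N = XC.CC.ten]] assoc_right_linear linear_intros rack_R_linear)

text \<open>This formula and \<open>R23_pure\<close>, together with linearity, are all that the
  final computation uses about the two operators; the associativity isomorphisms do not appear after
  them.\<close>

lemma R12_pure:
  assumes "x \<in> carrier X" "y \<in> carrier X" "z \<in> carrier X"
  shows "R12 (pure3 x y z) = tensor_lift T3.ten (\<lambda>a b. pure3 a (act x (\<nu> b)) z) (\<Delta>\<^sub>X y)"
proof -
  have "R12 (pure3 x y z) = T3.pure (R (XC.CC.pure x y)) z"
    unfolding tensor_on_left_def
    by (rule tensor_map_pure, (intro linear_intros rack_R_linear)+)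
      (use assms in \<open>simp_all add: XC.CC.pure_closed\<close>)
  also have "\<dots> = tensor_lift T3.ten (\<lambda>a b. pure3 a (act x (\<nu> b)) z) (\<Delta>\<^sub>X y)"
    unfolding rack_R_pure[OF assms(1,2)]
    by (rule XC.CC.linear_tensor_lift_eq[where f = "\<lambda>s. T3.pure s z"]; (intro linear_intros)?)
      (use assms in simp_all)
  finally show ?thesis .
qed

lemma R23_pure:
  assumes "x \<in> carrier X" "y \<in> carrier X" "z \<in> carrier X"
  shows "R23 (pure3 x y z) = tensor_lift T3.ten (\<lambda>a b. pure3 x a (act y (\<nu> b))) (\<Delta>\<^sub>X z)"
proof -
  interpret A: module_pair k X XC.CC.ten
    using XC.module_C XC.CC.module_tensor by (rule module_pair.intro)
  have "tensor_map k X XC.CC.ten (\<lambda>z. z) R (A.pure x (XC.CC.pure y z)) =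
      A.pure x (R (XC.CC.pure y z))"
    by (rule tensor_map_pure, (intro linear_intros rack_R_linear)+)
      (use assms in \<open>simp_all add: XC.CC.pure_closed\<close>)
  then have "R23 (pure3 x y z) = assoc_left k X X X (A.pure x (R (XC.CC.pure y z)))"
    using assms by (simp add: tensor_on_right_def assoc_right_pure XC.module_C)
  also have "\<dots> = tensor_lift T3.ten (\<lambda>a b. pure3 x a (act y (\<nu> b))) (\<Delta>\<^sub>X z)"
    unfolding rack_R_pure[OF assms(2,3)]
    by (rule XC.CC.linear_tensor_lift_eq[where f = "\<lambda>s. assoc_left k X X X (A.pure x s)"];
        (intro linear_intros linear_comp[OF assoc_left_linear])?)
      (use assms in \<open>simp_all add: assoc_left_pure XC.module_C XC.CC.pure_closed\<close>)
  finally show ?thesis .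
qed

section \<open>Comparison of the two sides\<close>

text \<open>In Sweedler notation:
  \<open>z\<^sub>1 \<otimes> y\<^sub>1 \<cdot> \<nu>(z\<^sub>3) \<otimes> (x \<cdot> \<nu>(z\<^sub>2)) \<cdot> \<nu>(y\<^sub>2 \<cdot> \<nu>(z\<^sub>4)) = z\<^sub>1 \<otimes> y\<^sub>1 \<cdot> \<nu>(z\<^sub>2) \<otimes> (x \<cdot> \<nu>(y\<^sub>2)) \<cdot> \<nu>(z\<^sub>3)\<close>.\<close>

lemma sweedler_exchange:
  assumes cocomm: "cocommutative k X \<Delta>\<^sub>X"
    and x: "x \<in> carrier X" and y1: "y1 \<in> carrier X" and y2: "y2 \<in> carrier X" and z: "z \<in> carrier X"
  shows "tensor_lift T3.ten (\<lambda>z1 z2. tensor_lift T3.ten (\<lambda>a b. tensor_lift T3.ten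
        (\<lambda>c d. pure3 a (act y1 (\<nu> c)) (act (act x (\<nu> b)) (\<nu> (act y2 (\<nu> d))))) (\<Delta>\<^sub>X z2)) (\<Delta>\<^sub>X z1)) (\<Delta>\<^sub>X z) =
    tensor_lift T3.ten (\<lambda>z1 z2. tensor_lift T3.ten
        (\<lambda>a b. pure3 a (act y1 (\<nu> b)) (act (act x (\<nu> y2)) (\<nu> z2))) (\<Delta>\<^sub>X z1)) (\<Delta>\<^sub>X z)"
proof -
  let ?L = "tensor_lift T3.ten"
  let ?G = "\<lambda>a b c d. pure3 a (act y1 (\<nu> c)) (act (act x (\<nu> b)) (\<nu> (act y2 (\<nu> d))))"
  let ?K = "\<lambda>a c s. pure3 a (act y1 (\<nu> c)) (act (act x (\<nu> y2)) (\<nu> s))"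
  \<comment> \<open>Once \<open>b\<close> and \<open>d\<close> are the two legs of one element
    \<open>s\<close>, \<open>act_mult\<close> merges the two actions on \<open>x\<close> into a
    single action by a product in \<open>H\<close>. That product sums to \<open>\<nu> y2\<close>
    times \<open>\<nu> s\<close> by \<open>sweedler_aug_act\<close>.\<close>
  have inner: "?L (\<lambda>b d. ?G a b c d) (\<Delta>\<^sub>X s) = ?K a c s"
    if "a \<in> carrier X" "c \<in> carrier X" "s \<in> carrier X" for a c s
  proof -
    have "pure3 a (act y1 (\<nu> c)) (act x
          (tensor_lift H (\<lambda>b d. \<nu> b \<otimes>\<^bsub>H\<^esub> \<nu> (act y2 (\<nu> d))) (\<Delta>\<^sub>X s))) =
        ?L (\<lambda>b d. ?G a b c d) (\<Delta>\<^sub>X s)"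
      by (rule XC.CC.linear_tensor_lift_eq[where f = "\<lambda>h. pure3 a (act y1 (\<nu> c)) (act x h)"];
          (intro linear_intros)?)
        (use that x y1 y2 in \<open>simp_all add: XC.CC.pure_closed act_mult\<close>)
    then show ?thesis
      using that x y1 y2 by (simp add: sweedler_aug_act act_mult)
  qed
  \<comment> \<open>Here \<open>r\<close> holds all legs of \<open>z\<close> but the first. The leg
    \<open>c\<close> stands between \<open>b\<close> and \<open>d\<close>: coassociativity puts
    \<open>b\<close> and \<open>c\<close> under one coproduct, cocommutativity exchanges them, and
    coassociativity in the other direction puts \<open>b\<close> together with
    \<open>d\<close>.\<close>
  have swap: "?L (\<lambda>b s. ?L (\<lambda>c d. ?G a b c d) (\<Delta>\<^sub>X s)) (\<Delta>\<^sub>X r) = ?L (\<lambda>c s. ?K a c s) (\<Delta>\<^sub>X r)"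
    if a: "a \<in> carrier X" and r: "r \<in> carrier X" for a r
  proof -
    have "?L (\<lambda>b s. ?L (\<lambda>c d. ?G a b c d) (\<Delta>\<^sub>X s)) (\<Delta>\<^sub>X r) =
        ?L (\<lambda>s d. ?L (\<lambda>b c. ?G a b c d) (\<Delta>\<^sub>X s)) (\<Delta>\<^sub>X r)"
      by (rule XC.sweedler_coassoc[symmetric], rule r, (intro linear_intros)+)
        (use a x y1 y2 in \<open>simp_all add: XC.CC.pure_closed\<close>)
    also have "\<dots> = ?L (\<lambda>s d. ?L (\<lambda>c b. ?G a b c d) (\<Delta>\<^sub>X s)) (\<Delta>\<^sub>X r)"
    proof (rule XC.CC.tensor_lift_cong)
      show "?L (\<lambda>b c. ?G a b c d) (\<Delta>\<^sub>X s) = ?L (\<lambda>c b. ?G a b c d) (\<Delta>\<^sub>X s)"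
        if "s \<in> carrier X" "d \<in> carrier X" for s d
        by (rule XC.sweedler_cocomm[OF cocomm that(1)], (intro linear_intros)+)
          (use that a x y1 y2 in \<open>simp_all add: XC.CC.pure_closed\<close>)
    qed (((intro linear_intros)?; use a r x y1 y2 in \<open>simp add: XC.CC.pure_closed\<close>)+)
    also have "\<dots> = ?L (\<lambda>c s. ?L (\<lambda>b d. ?G a b c d) (\<Delta>\<^sub>X s)) (\<Delta>\<^sub>X r)"
      by (rule XC.sweedler_coassoc, rule r, (intro linear_intros)+)
        (use a x y1 y2 in \<open>simp_all add: XC.CC.pure_closed\<close>)
    also have "\<dots> = ?L (\<lambda>c s. ?K a c s) (\<Delta>\<^sub>X r)"
      by (rule XC.CC.tensor_lift_cong; (intro linear_intros)?)
        (use a r x y1 y2 inner in \<open>simp_all add: XC.CC.pure_closed\<close>)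
    finally show ?thesis .
  qed
  \<comment> \<open>The first leg \<open>a\<close> is detached, so that \<open>swap\<close> applies
    to the rest with \<open>a\<close> fixed.\<close>
  have "?L (\<lambda>z1 z2. ?L (\<lambda>a b. ?L (\<lambda>c d. ?G a b c d) (\<Delta>\<^sub>X z2)) (\<Delta>\<^sub>X z1)) (\<Delta>\<^sub>X z) =
      ?L (\<lambda>a r. ?L (\<lambda>b s. ?L (\<lambda>c d. ?G a b c d) (\<Delta>\<^sub>X s)) (\<Delta>\<^sub>X r)) (\<Delta>\<^sub>X z)"
    by (rule XC.sweedler_coassoc, rule z, (intro linear_intros)+)
      (use x y1 y2 in \<open>simp_all add: XC.CC.pure_closed\<close>)
  also have "\<dots> = ?L (\<lambda>a r. ?L (\<lambda>c s. ?K a c s) (\<Delta>\<^sub>X r)) (\<Delta>\<^sub>X z)"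
    by (rule XC.CC.tensor_lift_cong; (intro linear_intros)?)
      (use x y1 y2 z swap in \<open>simp_all add: XC.CC.pure_closed\<close>)
  \<comment> \<open>Three legs remain. They are regrouped with the first two together, the shape
    that \<open>R12\<close> produces on the left side of the equation.\<close>
  also have "\<dots> = ?L (\<lambda>z2 s. ?L (\<lambda>a c. ?K a c s) (\<Delta>\<^sub>X z2)) (\<Delta>\<^sub>X z)"
    by (rule XC.sweedler_coassoc[symmetric], rule z, (intro linear_intros)+)
      (use x y1 y2 in \<open>simp_all add: XC.CC.pure_closed\<close>)
  finally show ?thesis .
qed

theorem yang_baxter_rack_R:
  assumes cocomm: "cocommutative k X \<Delta>\<^sub>X"
  shows "yang_baxter_operator k X R"
proof -
  let ?L = "tensor_lift T3.ten"
  note lin = linear_intros linear_comp[OF R12_linear] linear_comp[OF R23_linear]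
  have main: "R12 (R23 (R12 (pure3 x y z))) = R23 (R12 (R23 (pure3 x y z)))"
    if x: "x \<in> carrier X" and y: "y \<in> carrier X" and z: "z \<in> carrier X" for x y z
  proof -
    let ?G = "\<lambda>y1 y2 a b c d. pure3 a (act y1 (\<nu> c)) (act (act x (\<nu> b)) (\<nu> (act y2 (\<nu> d))))"
    have "R23 (R12 (pure3 x y z)) =
        ?L (\<lambda>y1 y2. ?L (\<lambda>z1 z2. pure3 y1 z1 (act (act x (\<nu> y2)) (\<nu> z2))) (\<Delta>\<^sub>X z)) (\<Delta>\<^sub>X y)"
      unfolding R12_pure[OF x y z]
      by (rule XC.CC.linear_tensor_lift_eq[OF T3.module_tensor T3.module_tensor R23_linear];
          (intro lin)?)
        (use x y z in \<open>simp_all add: R23_pure XC.CC.pure_closed\<close>)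
    moreover have R12_inner: "R12 (?L (\<lambda>z1 z2. pure3 y1 z1 (act (act x (\<nu> y2)) (\<nu> z2))) (\<Delta>\<^sub>X z)) =
        ?L (\<lambda>z1 z2. ?L (\<lambda>a b. pure3 a (act y1 (\<nu> b)) (act (act x (\<nu> y2)) (\<nu> z2)))
          (\<Delta>\<^sub>X z1)) (\<Delta>\<^sub>X z)"
      if "y1 \<in> carrier X" "y2 \<in> carrier X" for y1 y2
      by (rule XC.CC.linear_tensor_lift_eq[OF T3.module_tensor T3.module_tensor R12_linear];
          (intro lin)?)
        (use that x z in \<open>simp_all add: R12_pure XC.CC.pure_closed\<close>)
    have "R12 (?L (\<lambda>y1 y2. ?L (\<lambda>z1 z2. pure3 y1 z1 (act (act x (\<nu> y2)) (\<nu> z2)))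
          (\<Delta>\<^sub>X z)) (\<Delta>\<^sub>X y)) =
        ?L (\<lambda>y1 y2. ?L (\<lambda>z1 z2. ?L (\<lambda>a b. pure3 a (act y1 (\<nu> b)) (act (act x (\<nu> y2)) (\<nu> z2)))
          (\<Delta>\<^sub>X z1)) (\<Delta>\<^sub>X z)) (\<Delta>\<^sub>X y)"
      by (rule XC.CC.linear_tensor_lift_eq[OF T3.module_tensor T3.module_tensor R12_linear]; (intro lin)?)
        (use x y z R12_inner in \<open>simp_all add: XC.CC.pure_closed\<close>)
    ultimately have left: "R12 (R23 (R12 (pure3 x y z))) =
        ?L (\<lambda>y1 y2. ?L (\<lambda>z1 z2. ?L (\<lambda>a b. pure3 a (act y1 (\<nu> b)) (act (act x (\<nu> y2)) (\<nu> z2)))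
          (\<Delta>\<^sub>X z1)) (\<Delta>\<^sub>X z)) (\<Delta>\<^sub>X y)"
      by simp
    have "R12 (R23 (pure3 x y z)) =
        ?L (\<lambda>z1 z2. ?L (\<lambda>a b. pure3 a (act x (\<nu> b)) (act y (\<nu> z2))) (\<Delta>\<^sub>X z1)) (\<Delta>\<^sub>X z)"
      unfolding R23_pure[OF x y z]
      by (rule XC.CC.linear_tensor_lift_eq[OF T3.module_tensor T3.module_tensor R12_linear];
          (intro lin)?)
        (use x y z in \<open>simp_all add: R12_pure XC.CC.pure_closed\<close>)
    \<comment> \<open>In this application of \<open>R23\<close> the third factor is
      \<open>act y (\<nu> z2)\<close>, so its coproduct is opened by \<open>sweedler_act\<close>.
      The sum over \<open>y\<close> is then moved outside the one over \<open>z1\<close>.\<close>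
    moreover have R23_inner: "R23 (?L (\<lambda>a b. pure3 a (act x (\<nu> b)) (act y (\<nu> z2))) (\<Delta>\<^sub>X z1)) =
        ?L (\<lambda>y1 y2. ?L (\<lambda>a b. ?L (\<lambda>c d. ?G y1 y2 a b c d) (\<Delta>\<^sub>X z2)) (\<Delta>\<^sub>X z1)) (\<Delta>\<^sub>X y)"
      if z1: "z1 \<in> carrier X" and z2: "z2 \<in> carrier X" for z1 z2
    proof -
      have R23_act: "R23 (pure3 a (act x (\<nu> b)) (act y (\<nu> z2))) =
          ?L (\<lambda>y1 y2. ?L (\<lambda>c d. ?G y1 y2 a b c d) (\<Delta>\<^sub>X z2)) (\<Delta>\<^sub>X y)"
        if a: "a \<in> carrier X" and b: "b \<in> carrier X" for a b
      proof -
        have "R23 (pure3 a (act x (\<nu> b)) (act y (\<nu> z2))) =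
            ?L (\<lambda>u v. pure3 a u (act (act x (\<nu> b)) (\<nu> v))) (\<Delta>\<^sub>X (act y (\<nu> z2)))"
          using a b x y z2 by (simp add: R23_pure)
        also have "\<dots> = ?L (\<lambda>y1 y2. ?L (\<lambda>c d. ?G y1 y2 a b c d) (\<Delta>\<^sub>X z2)) (\<Delta>\<^sub>X y)"
          by (rule sweedler_act[OF y z2 T3.module_tensor]; (intro lin)?)
            (use a b x in \<open>simp_all add: XC.CC.pure_closed\<close>)
        finally show ?thesis .
      qed
      have "R23 (?L (\<lambda>a b. pure3 a (act x (\<nu> b)) (act y (\<nu> z2))) (\<Delta>\<^sub>X z1)) =
          ?L (\<lambda>a b. ?L (\<lambda>y1 y2. ?L (\<lambda>c d. ?G y1 y2 a b c d) (\<Delta>\<^sub>X z2)) (\<Delta>\<^sub>X y)) (\<Delta>\<^sub>X z1)"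
        by (rule XC.CC.linear_tensor_lift_eq[OF T3.module_tensor T3.module_tensor R23_linear]; (intro lin)?)
          (use x y z1 z2 R23_act in \<open>simp_all add: XC.CC.pure_closed\<close>)
      also have "\<dots> = ?L (\<lambda>y1 y2. ?L (\<lambda>a b. ?L (\<lambda>c d. ?G y1 y2 a b c d) (\<Delta>\<^sub>X z2))
          (\<Delta>\<^sub>X z1)) (\<Delta>\<^sub>X y)"
        by (rule tensor_lift_commute[where k = k and A = X and B = X and M = X and N = X]; (intro lin)?)
          (use x y z1 z2 in \<open>simp_all add: XC.CC.pure_closed\<close>)
      finally show ?thesis .
    qed
    have "R23 (?L (\<lambda>z1 z2. ?L (\<lambda>a b. pure3 a (act x (\<nu> b)) (act y (\<nu> z2)))
          (\<Delta>\<^sub>X z1)) (\<Delta>\<^sub>X z)) =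
        ?L (\<lambda>z1 z2. ?L (\<lambda>y1 y2. ?L (\<lambda>a b. ?L (\<lambda>c d. ?G y1 y2 a b c d) (\<Delta>\<^sub>X z2))
          (\<Delta>\<^sub>X z1)) (\<Delta>\<^sub>X y)) (\<Delta>\<^sub>X z)"
      by (rule XC.CC.linear_tensor_lift_eq[OF T3.module_tensor T3.module_tensor R23_linear]; (intro lin)?)
        (use x y z R23_inner in \<open>simp_all add: XC.CC.pure_closed\<close>)
    ultimately have "R23 (R12 (R23 (pure3 x y z))) =
        ?L (\<lambda>z1 z2. ?L (\<lambda>y1 y2. ?L (\<lambda>a b. ?L (\<lambda>c d. ?G y1 y2 a b c d) (\<Delta>\<^sub>X z2))
          (\<Delta>\<^sub>X z1)) (\<Delta>\<^sub>X y)) (\<Delta>\<^sub>X z)"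
      by simp
    \<comment> \<open>With the sum over \<open>y\<close> outermost on both sides, \<open>y1\<close>
      and \<open>y2\<close> are fixed and only sums over \<open>z\<close> are left to compare, as in
      \<open>sweedler_exchange\<close>.\<close>
    also have "\<dots> = ?L (\<lambda>y1 y2. ?L (\<lambda>z1 z2. ?L (\<lambda>a b. ?L (\<lambda>c d. ?G y1 y2 a b c d) (\<Delta>\<^sub>X z2))
        (\<Delta>\<^sub>X z1)) (\<Delta>\<^sub>X z)) (\<Delta>\<^sub>X y)"
      by (rule tensor_lift_commute[where k = k and A = X and B = X and M = X and N = X]; (intro lin)?)
        (use x y z in \<open>simp_all add: XC.CC.pure_closed\<close>)
    also have "\<dots> = R12 (R23 (R12 (pure3 x y z)))"
      unfolding left
      by (rule XC.CC.tensor_lift_cong; (intro lin)?)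
        (use x y z in \<open>simp_all add: XC.CC.pure_closed sweedler_exchange[OF cocomm]\<close>)
    finally show ?thesis by simp
  qed
  \<comment> \<open>A pure tensor of \<open>(X \<otimes> X) \<otimes> X\<close> has an arbitrary
    tensor \<open>s\<close> as first factor. Extensionality is therefore used twice, in
    \<open>s\<close> here and in \<open>t\<close> below.\<close>
  have pure: "R12 (R23 (R12 (T3.pure s z))) = R23 (R12 (R23 (T3.pure s z)))"
    if s: "s \<in> carrier XC.CC.ten" and z: "z \<in> carrier X" for s z
    by (rule XC.CC.tensor_linear_ext[OF T3.module_tensor _ _ _ s]; (intro lin)?)
      (use z main in simp_all)
  show ?thesis
    unfolding yang_baxter_operator_def
  proof (intro conjI ballI rack_R_linear)
    fix t assume t: "t \<in> carrier T3.ten"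
    show "R12 (R23 (R12 t)) = R23 (R12 (R23 t))"
      by (rule T3.tensor_linear_ext[OF T3.module_tensor _ _ _ t]; (intro lin)?)
        (use pure in simp_all)
  qed
qed

end

theorem theorem3p11:
  fixes k :: "'k ring"
    and H :: "('k, 'h) module" and \<Delta>\<^sub>H :: "'h \<Rightarrow> ('h, 'h) tensor" and \<epsilon>\<^sub>H :: "'h \<Rightarrow> 'k"
    and S :: "'h \<Rightarrow> 'h"
    and X :: "('k, 'x) module" and \<Delta>\<^sub>X :: "'x \<Rightarrow> ('x, 'x) tensor" and \<epsilon>\<^sub>X :: "'x \<Rightarrow> 'k"
    and act :: "'x \<Rightarrow> 'h \<Rightarrow> 'x" and \<nu> :: "'x \<Rightarrow> 'h"
  assumes "categorical_augmented_rack k H \<Delta>\<^sub>H \<epsilon>\<^sub>H S X \<Delta>\<^sub>X \<epsilon>\<^sub>X act \<nu>"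
    and "cocommutative k X \<Delta>\<^sub>X"
  shows "yang_baxter_operator k X (rack_R k X \<Delta>\<^sub>X act \<nu>)"
  using assms by (rule categorical_augmented_rack.yang_baxter_rack_R)

end
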